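(* Let $d\ge n$ and let $H$ be a subgroup of $GL_n$. If the $GL_d$-module $GL_d*j({}^Hk[M_{n,n}])$ has a good filtration, then $GL_d*j({}^Hk[M_{n,n}])={}^Hk[M_{n,d}]$.
   Context: $k$ is an algebraically closed field of characteristic $p\ge 0$; $GL_m=GL_m(k)$; $M_{n,d}$ is the space of $n\times d$ matrices over $k$, with $d\ge n$, and $x=(x_1,\dots,x_d)\in M_{n,d}$ has $i$th column $x_i$. $H\subset GL_n$ acts on $k[M_{n,d}]$ by $(hF)(x)=F(h^{-1}x)$, with algebra of invariants ${}^Hk[M_{n,d}]$. $GL_d$ acts on $k[M_{n,d}]$ by $(g*F)(x)=F(xg)$. The map $j:k[M_{n,n}]\to k[M_{n,d}]$ is $(jF)(x_1,\dots,x_d)=F(x_1,\dots,x_n)$. $GL_d*j({}^Hk[M_{n,n}])$ is the $k$-algebra generated by all $g*jf$ with $g\in GL_d$, $f\in{}^Hk[M_{n,n}]$. Good filtrations. Let $G=GL_m$, $T$ its diagonal torus, $B=TU$ the upper triangular Borel subgroup with $U$ upper unitriangular, $U^-$ the lower unitriangular matrices, $X^+(T)$ the dominant weights (relative to $B$). On $k[G]$ put $(\ell_gf)(x)=f(g^{-1}x)$ and $(r_gf)(x)=f(xg)$; $k[G/U^-]$ is the algebra of $f\in k[G]$ with $r_uf=f$ for all $u\in U^-$. For $\omega\in X^+(T)$ let $Y(\omega)=\{f\in k[G/U^-]: r_tf=\omega(t)^{-1}f\ \forall t\in T\}$, a $G$-module under left translation. A good filtration of a rational $G$-module $V$ is a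 sequence of $G$-stable subspaces $0=V_0\subset V_1\subset\cdots$ with $V=\bigcup V_i$ and each $V_i/V_{i-1}$ isomorphic to some $Y(\omega_i)$, $\omega_i\in X^+(T)$. *)

theory Defs
  imports
    "HOL-Library.Extended_Nat"
    "HOL-Library.Function_Algebras"
    "HOL-Computational_Algebra.Computational_Algebra"
    "Jordan_Normal_Form.Determinant"
begin

section \<open>Coordinate rings as algebras of functions\<close>

text \<open>
  The ground field is infinite, so the coordinate ring of an affine variety \<open>X\<close> is the algebra of
  its regular functions. A function on \<open>X\<close> is represented by a function on the whole type which
  is \<open>0\<close> outside \<open>X\<close>; this keeps equality of functions on \<open>X\<close> equal to HOL equality, and the
  pointwise operations of \<^theory>\<open>HOL-Library.Function_Algebras\<close> applicable.
\<close>

definition fun_on :: "'x set \<Rightarrow> ('x \<Rightarrow> 'a::zero) \<Rightarrow> 'x \<Rightarrow> 'a" where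
  "fun_on X f = (\<lambda>x. if x \<in> X then f x else 0)"

definition fscale :: "'a::field \<Rightarrow> ('x \<Rightarrow> 'a) \<Rightarrow> 'x \<Rightarrow> 'a" where
  "fscale c f = (\<lambda>x. c * f x)"

interpretation fun_space: vector_space fscale
  by unfold_locales (simp_all add: fscale_def fun_eq_iff algebra_simps)

inductive_set generated_algebra :: "'x set \<Rightarrow> ('x \<Rightarrow> 'a::field) set \<Rightarrow> ('x \<Rightarrow> 'a) set"
  for X :: "'x set" and S :: "('x \<Rightarrow> 'a) set" where
  const: "fun_on X (\<lambda>_. c) \<in> generated_algebra X S"
| gen: "f \<in> S \<Longrightarrow> f \<in> generated_algebra X S"
| add: "f \<in> generated_algebra X S \<Longrightarrow> g \<in> generated_algebra X S \<Longrightarrow> f + g \<in> generated_algebra X S"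
| mult: "f \<in> generated_algebra X S \<Longrightarrow> g \<in> generated_algebra X S \<Longrightarrow> f * g \<in> generated_algebra X S"

definition mat_poly_funs :: "nat \<Rightarrow> nat \<Rightarrow> ('a::field mat \<Rightarrow> 'a) set" where
  "mat_poly_funs n d = generated_algebra (carrier_mat n d)
     {fun_on (carrier_mat n d) (\<lambda>x. x $$ (i, j)) | i j. i < n \<and> j < d}"

definition GL :: "nat \<Rightarrow> 'a::field mat monoid" where
  "GL m = units_of (ring_mat TYPE('a) m ())"

text \<open>\<open>k[GL\<^sub>m]\<close>, the localization of \<open>k[M\<^bsub>m,m\<^esub>]\<close> at the determinant\<close>

definition GL_regular_funs :: "nat \<Rightarrow> ('a::field mat \<Rightarrow> 'a) set" where
  "GL_regular_funs m =
     {fun_on (carrier (GL m)) (\<lambda>x. F x / det x ^ r) | F r. F \<in> mat_poly_funs m m}"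

definition left_transl :: "nat \<Rightarrow> 'a::field mat set \<Rightarrow> 'a mat \<Rightarrow> ('a mat \<Rightarrow> 'a) \<Rightarrow> 'a mat \<Rightarrow> 'a" where
  "left_transl m X g f = fun_on X (\<lambda>x. f (inv\<^bsub>GL m\<^esub> g * x))"

definition right_transl :: "'a::field mat set \<Rightarrow> 'a mat \<Rightarrow> ('a mat \<Rightarrow> 'a) \<Rightarrow> 'a mat \<Rightarrow> 'a" where
  "right_transl X g f = fun_on X (\<lambda>x. f (x * g))"


section \<open>Good filtrations\<close>

definition torus :: "nat \<Rightarrow> 'a::field mat set" where
  "torus m = {t \<in> carrier (GL m). diagonal_mat t}"

definition lower_unitriangular :: "nat \<Rightarrow> 'a::field mat set" where
  "lower_unitriangular m = {u \<in> carrier_mat m m.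
     (\<forall>i<m. u $$ (i, i) = 1) \<and> (\<forall>i<m. \<forall>j<m. i < j \<longrightarrow> u $$ (i, j) = 0)}"

text \<open>
  The character group of the diagonal torus is identified with \<open>\<int>\<^sup>m\<close>; an \<open>m\<close>-tuple of integers is
  given by the values of \<open>a\<close> below \<open>m\<close>. The simple roots of the upper triangular Borel subgroup
  are \<open>\<epsilon>\<^sub>i - \<epsilon>\<^bsub>i+1\<^esub>\<close>, so dominant means weakly decreasing.
\<close>

definition weight :: "nat \<Rightarrow> (nat \<Rightarrow> int) \<Rightarrow> 'a::field mat \<Rightarrow> 'a" where
  "weight m a t = (\<Prod>i<m. (t $$ (i, i)) powi a i)"

definition dominant :: "nat \<Rightarrow> (nat \<Rightarrow> int) \<Rightarrow> bool" where
  "dominant m a \<longleftrightarrow> (\<forall>i. Suc i < m \<longrightarrow> a i \<ge> a (Suc i))"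

text \<open>
  \<open>Y_module m a\<close> consists of the regular functions with \<open>f(xtu) = a(t)\<inverse> f(x)\<close>. Under left
  translation its highest weight relative to the upper triangular Borel subgroup is \<open>a\<close>.
\<close>

definition funs_mod_lower_unitriangular :: "nat \<Rightarrow> ('a::field mat \<Rightarrow> 'a) set" where
  "funs_mod_lower_unitriangular m =
     {f \<in> GL_regular_funs m. \<forall>u\<in>lower_unitriangular m. right_transl (carrier (GL m)) u f = f}"

definition Y_module :: "nat \<Rightarrow> (nat \<Rightarrow> int) \<Rightarrow> ('a::field mat \<Rightarrow> 'a) set" where
  "Y_module m a =
     {f \<in> funs_mod_lower_unitriangular m.
        \<forall>t\<in>torus m. right_transl (carrier (GL m)) t f = fscale (inverse (weight m a t)) f}"

definition coset :: "('x \<Rightarrow> 'a::field) set \<Rightarrow> ('x \<Rightarrow> 'a) \<Rightarrow> ('x \<Rightarrow> 'a) set" where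
  "coset W v = (\<lambda>w. v + w) ` W"

definition stable_subspace ::
  "nat \<Rightarrow> ('a::field mat \<Rightarrow> ('x \<Rightarrow> 'a) \<Rightarrow> 'x \<Rightarrow> 'a) \<Rightarrow> ('x \<Rightarrow> 'a) set \<Rightarrow> bool" where
  "stable_subspace m act V \<longleftrightarrow>
     fun_space.subspace V \<and> (\<forall>g\<in>carrier (GL m). \<forall>v\<in>V. act g v \<in> V)"

text \<open>
  The quotient \<open>V/W\<close> of \<open>GL\<^sub>m\<close>-modules is isomorphic to the \<open>GL\<^sub>m\<close>-module \<open>Y\<close>; the module
  structure of \<open>V/W\<close>, the set of cosets, is spelled out on representatives.
\<close>

definition quotient_isomorphic ::
  "nat \<Rightarrow> ('a::field mat \<Rightarrow> ('x \<Rightarrow> 'a) \<Rightarrow> 'x \<Rightarrow> 'a) \<Rightarrow> ('x \<Rightarrow> 'a) set \<Rightarrow> ('x \<Rightarrow> 'a) set \<Rightarrow>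
   ('a mat \<Rightarrow> ('y \<Rightarrow> 'a) \<Rightarrow> 'y \<Rightarrow> 'a) \<Rightarrow> ('y \<Rightarrow> 'a) set \<Rightarrow> bool" where
  "quotient_isomorphic m act V W act' Y \<longleftrightarrow>
     (\<exists>\<phi>. bij_betw \<phi> (coset W ` V) Y \<and>
       (\<forall>v\<in>V. \<forall>v'\<in>V. \<phi> (coset W (v + v')) = \<phi> (coset W v) + \<phi> (coset W v')) \<and>
       (\<forall>c. \<forall>v\<in>V. \<phi> (coset W (fscale c v)) = fscale c (\<phi> (coset W v))) \<and>
       (\<forall>g\<in>carrier (GL m). \<forall>v\<in>V. \<phi> (coset W (act g v)) = act' g (\<phi> (coset W v))))"

text \<open>
  The filtration may be finite, with last term \<open>F N\<close>, or infinite, with \<open>N = \<infinity>\<close>. Finite-dimensional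
  modules only have finite ones, since \<open>Y(\<omega>) \<noteq> 0\<close> for dominant \<open>\<omega>\<close>. That \<open>V\<close> is a rational
  module is not part of the predicate; stable subspaces of \<open>k[M\<^bsub>n,d\<^esub>]\<close> always are.
\<close>

definition has_good_filtration ::
  "nat \<Rightarrow> ('a::field mat \<Rightarrow> ('x \<Rightarrow> 'a) \<Rightarrow> 'x \<Rightarrow> 'a) \<Rightarrow> ('x \<Rightarrow> 'a) set \<Rightarrow> bool" where
  "has_good_filtration m act V \<longleftrightarrow>
     (\<exists>(N :: enat) F.
        F 0 = {0} \<and>
        (\<forall>i. enat i \<le> N \<longrightarrow> stable_subspace m act (F i)) \<and>
        V = (\<Union>i\<in>{i. enat i \<le> N}. F i) \<and>
        (\<forall>i. enat (Suc i) \<le> N \<longrightarrow>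
           F i \<subseteq> F (Suc i) \<and>
           (\<exists>a. dominant m a \<and>
              quotient_isomorphic m act (F (Suc i)) (F i)
                (left_transl m (carrier (GL m))) (Y_module m a))))"


section \<open>Vector invariants\<close>

definition invariants :: "nat \<Rightarrow> nat \<Rightarrow> 'a::field mat set \<Rightarrow> ('a mat \<Rightarrow> 'a) set" where
  "invariants n d H =
     {F \<in> mat_poly_funs n d. \<forall>h\<in>H. left_transl n (carrier_mat n d) h F = F}"

definition first_columns :: "nat \<Rightarrow> 'a mat \<Rightarrow> 'a mat" where
  "first_columns n x = mat n n (\<lambda>(i, j). x $$ (i, j))"

definition j_map :: "nat \<Rightarrow> nat \<Rightarrow> ('a::field mat \<Rightarrow> 'a) \<Rightarrow> 'a mat \<Rightarrow> 'a" where
  "j_map n d F = fun_on (carrier_mat n d) (\<lambda>x. F (first_columns n x))"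

text \<open>The action \<open>(g * F)(x) = F(xg)\<close> of \<open>GL\<^sub>d\<close> on \<open>k[M\<^bsub>n,d\<^esub>]\<close> is
  \<^term>\<open>right_transl (carrier_mat n d)\<close>.\<close>

definition polarization_algebra :: "nat \<Rightarrow> nat \<Rightarrow> 'a::field mat set \<Rightarrow> ('a mat \<Rightarrow> 'a) set" where
  "polarization_algebra n d H = generated_algebra (carrier_mat n d)
     {right_transl (carrier_mat n d) g (j_map n d f) | g f.
        g \<in> carrier (GL d) \<and> f \<in> invariants n n H}"

end

theory Submission
  imports Defs
begin

text \<open>
  Let \<open>V \<subseteq> B \<subseteq> k[M\<^bsub>n,d\<^esub>]\<close> be \<open>GL\<^sub>d\<close>-submodules such that \<open>V\<close> has a good filtration \<open>F\<^sub>0 \<subseteq> F\<^sub>1 \<subseteq> \<dots>\<close> and contains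
  all \<open>U\<close>-invariants of \<open>B\<close>; then \<open>V = B\<close>. Grade \<open>k[M\<^bsub>n,d\<^esub>]\<close> by the cocharacter
  \<open>\<gamma>(s) = diag(s\<^sup>d, \<dots>, s)\<close>: elements of \<open>U\<close> raise degrees and elements of \<open>U\<^sup>-\<close> lower them. If \<open>B \<noteq> V\<close>,
  then a homogeneous \<open>b \<in> B - V\<close> of maximal degree \<open>k\<close> satisfies \<open>(u - 1)b \<in> V\<close> for all \<open>u \<in> U\<close>, hence
  \<open>(u - 1)b \<in> F\<^sub>i\<close> for some \<open>i\<close>. Subtracting elements of the filtration from \<open>b\<close>, one lowers \<open>i\<close> to \<open>0\<close>, which
  makes \<open>b\<close> a \<open>U\<close>-invariant. To pass from \<open>F\<^bsub>i+1\<^esub>\<close> to \<open>F\<^sub>i\<close> with \<open>F\<^bsub>i+1\<^esub>/F\<^sub>i \<cong> Y(\<omega>)\<close>, let \<open>\<epsilon>\<close> be the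
  evaluation of \<open>Y(\<omega>)\<close> at \<open>1\<close> and \<open>h\<close> the degree of \<open>\<omega>\<close>. If \<open>h \<le> k\<close>, nothing of degree greater than \<open>k\<close>
  survives in \<open>Y(\<omega>)\<close> and \<open>(u - 1)b \<in> F\<^sub>i\<close> already. If \<open>h > k\<close>, extend \<open>\<epsilon>\<close> by \<open>0\<close> on the degrees
  at most \<open>k\<close>; on the big cell \<open>U\<^sup>-TU\<close> one has \<open>\<epsilon>(u\<^sup>-tub) = \<omega>(t) \<epsilon>((u - 1)b)\<close>, so
  \<open>g \<mapsto> \<epsilon>(g\<inverse>b)\<close> lies in \<open>Y(\<omega>)\<close>, and an element of \<open>F\<^bsub>i+1\<^esub>\<close> representing it is the correction.

  For the invariants of \<open>H\<close> the condition on \<open>U\<close>-invariants holds because a generic matrix is moved by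
  \<open>U\<close> to one whose columns after the \<open>n\<close>th vanish.
\<close>

section \<open>Polynomial functions on matrices\<close>

lemma fun_on_apply [simp]: "x \<in> X \<Longrightarrow> fun_on X f x = f x" "x \<notin> X \<Longrightarrow> fun_on X f x = 0"
  by (simp_all add: fun_on_def)

lemma fun_on_add: "fun_on X (\<lambda>x. f x + g x) = fun_on X f + fun_on X (g :: _ \<Rightarrow> 'a::field)"
  and fun_on_mult: "fun_on X (\<lambda>x. f x * g x) = fun_on X f * fun_on X g"
  by (auto simp: fun_on_def fun_eq_iff)

lemma fun_on_cong: "(\<And>x. x \<in> X \<Longrightarrow> f x = g x) \<Longrightarrow> fun_on X f = fun_on X g"
  by (auto simp: fun_on_def)

lemma mat_poly_funs_induct [consumes 1, case_names const entry add mult]: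
  assumes "F \<in> mat_poly_funs n d"
    and "\<And>c. P (fun_on (carrier_mat n d) (\<lambda>_. c))"
    and "\<And>i j. i < n \<Longrightarrow> j < d \<Longrightarrow> P (fun_on (carrier_mat n d) (\<lambda>x. x $$ (i, j)))"
    and "\<And>F G. F \<in> mat_poly_funs n d \<Longrightarrow> G \<in> mat_poly_funs n d \<Longrightarrow> P F \<Longrightarrow> P G \<Longrightarrow> P (F + G)"
    and "\<And>F G. F \<in> mat_poly_funs n d \<Longrightarrow> G \<in> mat_poly_funs n d \<Longrightarrow> P F \<Longrightarrow> P G \<Longrightarrow> P (F * G)"
  shows "P F"
  using assms(1) unfolding mat_poly_funs_def
proof (induction rule: generated_algebra.induct)
  case (const c)
  show ?case by (rule assms(2))
next
  case (gen f)
  then show ?case using assms(3) by blast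
next
  case (add f g)
  then show ?case by (intro assms(4)) (unfold mat_poly_funs_def)
next
  case (mult f g)
  then show ?case by (intro assms(5)) (unfold mat_poly_funs_def)
qed

lemma mat_poly_const: "fun_on (carrier_mat n d) (\<lambda>_. c) \<in> mat_poly_funs n d"
  by (simp add: mat_poly_funs_def generated_algebra.const)

lemma mat_poly_entry:
  "i < n \<Longrightarrow> j < d \<Longrightarrow> fun_on (carrier_mat n d) (\<lambda>x. x $$ (i, j)) \<in> mat_poly_funs n d"
  unfolding mat_poly_funs_def by (intro generated_algebra.gen) auto

lemma mat_poly_add: "F \<in> mat_poly_funs n d \<Longrightarrow> G \<in> mat_poly_funs n d \<Longrightarrow> F + G \<in> mat_poly_funs n d"
  by (simp add: mat_poly_funs_def generated_algebra.add)

lemma mat_poly_mult: "F \<in> mat_poly_funs n d \<Longrightarrow> G \<in> mat_poly_funs n d \<Longrightarrow> F * G \<in> mat_poly_funs n d"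
  by (simp add: mat_poly_funs_def generated_algebra.mult)

lemma mat_poly_outside:
  assumes "F \<in> mat_poly_funs n d" and "x \<notin> carrier_mat n d"
  shows "F x = 0"
  using assms by (induction rule: mat_poly_funs_induct) auto

lemma subspace_mat_poly_funs: "fun_space.subspace (mat_poly_funs n d)"
proof -
  have "fscale c F \<in> mat_poly_funs n d" if "F \<in> mat_poly_funs n d" for c and F :: "'a mat \<Rightarrow> 'a"
  proof -
    \<comment> \<open>Vanishing of \<open>F\<close> off the carrier makes multiplication by the
      truncated constant agree with \<open>fscale c\<close>.\<close>
    have "fscale c F = fun_on (carrier_mat n d) (\<lambda>_. c) * F"
      using mat_poly_outside[OF that] by (auto simp: fun_on_def fscale_def fun_eq_iff)
    thus ?thesis by (simp add: mat_poly_mult mat_poly_const that)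
  qed
  moreover have "(0 :: 'a mat \<Rightarrow> 'a) \<in> mat_poly_funs n d"
    using mat_poly_const[of n d 0] by (simp add: fun_on_def zero_fun_def)
  ultimately show ?thesis
    by (simp add: fun_space.subspace_def mat_poly_add)
qed

lemmas mat_poly_zero = fun_space.subspace_0[OF subspace_mat_poly_funs]
  and mat_poly_scale = fun_space.subspace_scale[OF subspace_mat_poly_funs]
  and mat_poly_diff = fun_space.subspace_diff[OF subspace_mat_poly_funs]

text \<open>A morphism of affine spaces in coordinates. Values of \<open>\<psi>\<close> off the
  carrier are left free, so matrix operations such as \<open>adj_mat\<close> qualify as they
  are.\<close>

definition mat_poly_map :: "nat \<Rightarrow> nat \<Rightarrow> nat \<Rightarrow> nat \<Rightarrow> ('a::field mat \<Rightarrow> 'a mat) \<Rightarrow> bool" where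
  "mat_poly_map n d n' d' \<psi> \<longleftrightarrow> (\<forall>x\<in>carrier_mat n d. \<psi> x \<in> carrier_mat n' d') \<and>
     (\<forall>i<n'. \<forall>j<d'. fun_on (carrier_mat n d) (\<lambda>x. \<psi> x $$ (i, j)) \<in> mat_poly_funs n d)"

lemma mat_poly_compose:
  assumes "F \<in> mat_poly_funs n' d'" and "mat_poly_map n d n' d' \<psi>"
  shows "fun_on (carrier_mat n d) (\<lambda>x. F (\<psi> x)) \<in> mat_poly_funs n d"
  using assms(1)
proof (induction rule: mat_poly_funs_induct)
  case (const c)
  have "fun_on (carrier_mat n d) (\<lambda>x. fun_on (carrier_mat n' d') (\<lambda>_. c) (\<psi> x))
      = fun_on (carrier_mat n d) (\<lambda>_. c)"
    using assms(2) by (intro fun_on_cong) (auto simp: mat_poly_map_def)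
  thus ?case by (simp add: mat_poly_const)
next
  case (entry i j)
  have "fun_on (carrier_mat n d) (\<lambda>x. fun_on (carrier_mat n' d') (\<lambda>x. x $$ (i, j)) (\<psi> x))
      = fun_on (carrier_mat n d) (\<lambda>x. \<psi> x $$ (i, j))"
    using assms(2) by (intro fun_on_cong) (auto simp: mat_poly_map_def)
  thus ?case using assms(2) entry by (auto simp: mat_poly_map_def)
next
  case (add F G)
  then show ?case unfolding plus_fun_apply by (subst fun_on_add) (intro mat_poly_add)
next
  case (mult F G)
  then show ?case unfolding times_fun_apply by (subst fun_on_mult) (intro mat_poly_mult)
qed

lemma mat_poly_on_sum:
  "(\<And>i. i \<in> I \<Longrightarrow> fun_on (carrier_mat n d) (f i) \<in> mat_poly_funs n d) \<Longrightarrow>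
    fun_on (carrier_mat n d) (\<lambda>x. \<Sum>i\<in>I. f i x) \<in> mat_poly_funs n d"
  by (induction I rule: infinite_finite_induct)
     (simp_all add: mat_poly_const fun_on_add mat_poly_add)

lemma mat_poly_on_prod:
  "(\<And>i. i \<in> I \<Longrightarrow> fun_on (carrier_mat n d) (f i) \<in> mat_poly_funs n d) \<Longrightarrow>
    fun_on (carrier_mat n d) (\<lambda>x. \<Prod>i\<in>I. f i x) \<in> mat_poly_funs n d"
  by (induction I rule: infinite_finite_induct)
     (simp_all add: mat_poly_const fun_on_mult mat_poly_mult)

lemma mat_poly_map_const: "A \<in> carrier_mat n' d' \<Longrightarrow> mat_poly_map n d n' d' (\<lambda>_. A)"
  by (simp add: mat_poly_map_def mat_poly_const)

lemma mat_poly_map_id: "mat_poly_map n d n d (\<lambda>x. x)"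
  by (simp add: mat_poly_map_def mat_poly_entry)

lemma mat_poly_map_mult:
  assumes "mat_poly_map n d a b \<psi>" and "mat_poly_map n d b c \<chi>"
  shows "mat_poly_map n d a c (\<lambda>x. \<psi> x * \<chi> x)"
  unfolding mat_poly_map_def
proof (intro conjI ballI allI impI)
  show "\<psi> x * \<chi> x \<in> carrier_mat a c" if "x \<in> carrier_mat n d" for x
    using assms that unfolding mat_poly_map_def by (meson mult_carrier_mat)
next
  fix i j assume ij: "i < a" "j < c"
  have "fun_on (carrier_mat n d) (\<lambda>x. (\<psi> x * \<chi> x) $$ (i, j))
      = fun_on (carrier_mat n d) (\<lambda>x. \<Sum>k<b. \<psi> x $$ (i, k) * \<chi> x $$ (k, j))"
  proof (rule fun_on_cong)
    fix x :: "'a mat" assume "x \<in> carrier_mat n d"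
    hence "\<psi> x \<in> carrier_mat a b" "\<chi> x \<in> carrier_mat b c"
      using assms by (auto simp: mat_poly_map_def)
    thus "(\<psi> x * \<chi> x) $$ (i, j) = (\<Sum>k<b. \<psi> x $$ (i, k) * \<chi> x $$ (k, j))"
      using ij by (auto simp: scalar_prod_def atLeast0LessThan)
  qed
  also have "\<dots> \<in> mat_poly_funs n d"
    using assms ij
    by (intro mat_poly_on_sum) (auto simp: fun_on_mult mat_poly_map_def intro!: mat_poly_mult)
  finally show "fun_on (carrier_mat n d) (\<lambda>x. (\<psi> x * \<chi> x) $$ (i, j)) \<in> mat_poly_funs n d" .
qed

lemma mat_poly_det: "fun_on (carrier_mat m m) det \<in> mat_poly_funs m m"
proof -
  have "fun_on (carrier_mat m m) det = fun_on (carrier_mat m m)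
      (\<lambda>x. \<Sum>p \<in> {p. p permutes {0..<m}}. signof p * (\<Prod>i = 0..<m. x $$ (i, p i)))"
    by (intro fun_on_cong) (simp add: det_def')
  also have "\<dots> \<in> mat_poly_funs m m"
  proof (intro mat_poly_on_sum)
    fix p :: "nat \<Rightarrow> nat" assume "p \<in> {p. p permutes {0..<m}}"
    hence "i < m \<Longrightarrow> p i < m" for i
      using permutes_in_image[of p "{0..<m}" i] by auto
    thus "fun_on (carrier_mat m m) (\<lambda>x. signof p * (\<Prod>i = 0..<m. x $$ (i, p i))) \<in> mat_poly_funs m m"
      by (subst fun_on_mult) (auto intro!: mat_poly_mult mat_poly_const mat_poly_on_prod mat_poly_entry)
  qed
  finally show ?thesis .
qed

lemma mat_poly_map_first_columns:
  "k \<le> n \<Longrightarrow> k \<le> d \<Longrightarrow> mat_poly_map n d k k (first_columns k)"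
  by (auto simp: mat_poly_map_def first_columns_def intro: mat_poly_entry)

lemma first_columns_carrier [simp]: "first_columns k x \<in> carrier_mat k k"
  by (simp add: first_columns_def)

lemma mat_poly_leading_minor:
  assumes "k \<le> n" "k \<le> d"
  shows "fun_on (carrier_mat n d) (\<lambda>x. det (first_columns k x)) \<in> mat_poly_funs n d"
  using mat_poly_compose[OF mat_poly_det mat_poly_map_first_columns[OF assms]]
  by simp

lemma mat_poly_map_mat_delete:
  assumes "i < m" "j < m"
  shows "mat_poly_map m m (m - 1) (m - 1) (\<lambda>x. mat_delete x i j)"
  unfolding mat_poly_map_def
proof (intro conjI ballI allI impI)
  fix a b assume "a < m - 1" "b < m - 1"
  thus "fun_on (carrier_mat m m) (\<lambda>x. mat_delete x i j $$ (a, b)) \<in> mat_poly_funs m m"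
    using mat_poly_entry[of "if a < i then a else Suc a" m "if b < j then b else Suc b" m] assms
    by (subst fun_on_cong[where g = "\<lambda>x. x $$ (if a < i then a else Suc a, if b < j then b else Suc b)"])
       (auto simp: mat_delete_def)
qed (auto intro: mat_delete_carrier)

text \<open>Each entry is a signed minor. These are the numerators in Cramer's formula, through
  which inversion on \<open>GL m\<close> becomes regular.\<close>

lemma mat_poly_map_adj_mat: "mat_poly_map m m m m adj_mat"
  unfolding mat_poly_map_def
proof (intro conjI ballI allI impI)
  fix i j assume ij: "i < m" "j < m"
  have "fun_on (carrier_mat m m) (\<lambda>x. adj_mat x $$ (i, j)) =
      fun_on (carrier_mat m m) (\<lambda>x. (- 1) ^ (j + i) * det (mat_delete x j i))"
    using ij by (intro fun_on_cong) (auto simp: adj_mat_def cofactor_def)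
  also have "\<dots> = fun_on (carrier_mat m m) (\<lambda>_. (- 1) ^ (j + i)) *
      fun_on (carrier_mat m m) (\<lambda>x. fun_on (carrier_mat (m - 1) (m - 1)) det (mat_delete x j i))"
    using mat_delete_carrier[of _ m m] by (auto simp: fun_on_def fun_eq_iff)
  also have "\<dots> \<in> mat_poly_funs m m"
    by (intro mat_poly_mult mat_poly_const mat_poly_compose[OF mat_poly_det]
          mat_poly_map_mat_delete ij)
  finally show "fun_on (carrier_mat m m) (\<lambda>x. adj_mat x $$ (i, j)) \<in> mat_poly_funs m m" .
qed (auto simp: adj_mat_def)

text \<open>Restriction to a polynomial curve turns identities between functions of matrices into
  identities of polynomials in one variable, whose coefficients can be compared.\<close>

lemma mat_poly_along_curve:
  assumes "F \<in> mat_poly_funs n d" and "\<And>s. \<psi> s \<in> carrier_mat n d"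
    and "\<And>i j. i < n \<Longrightarrow> j < d \<Longrightarrow> \<exists>p. \<forall>s. \<psi> s $$ (i, j) = poly p s"
  shows "\<exists>p. \<forall>s. F (\<psi> s) = poly p s"
  using assms(1)
proof (induction rule: mat_poly_funs_induct)
  case (const c)
  show ?case by (rule exI[of _ "[:c:]"]) (simp add: assms)
next
  case (entry i j)
  then show ?case by (simp add: assms)
next
  case (add F G)
  then obtain p q where "\<forall>s. F (\<psi> s) = poly p s" "\<forall>s. G (\<psi> s) = poly q s" by blast
  then show ?case by (intro exI[of _ "p + q"]) simp
next
  case (mult F G)
  then obtain p q where "\<forall>s. F (\<psi> s) = poly p s" "\<forall>s. G (\<psi> s) = poly q s" by blast
  then show ?case by (intro exI[of _ "p * q"]) simp
qed


section \<open>Density\<close>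

lemma infinite_UNIV_alg_closed: "infinite (UNIV :: 'a::alg_closed_field set)"
proof
  assume fin: "finite (UNIV :: 'a set)"
  define p :: "'a poly" where "p = (\<Prod>a\<in>UNIV. [:- a, 1:])"
  have "degree p = card (UNIV :: 'a set)"
    unfolding p_def by (subst degree_prod_sum_eq) auto
  \<comment> \<open>\<open>p + 1\<close> takes only the value \<open>1\<close>, yet a finite field
    would give it positive degree and hence a root.\<close>
  hence "degree (p + 1) > 0"
    using fin by (simp add: degree_add_eq_left finite_UNIV_card_ge_0)
  then obtain x where "poly (p + 1) x = 0" using alg_closed_imp_poly_has_root by blast
  moreover have "poly p x = 0" using fin by (auto simp: p_def poly_prod)
  ultimately show False by simp
qed

text \<open>The point \<open>0\<close> is exempt because \<open>s\<close> will be the parameter of a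
  one-parameter torus.\<close>

lemma poly_eq_0_if_infinite_roots:
  fixes p :: "'a::alg_closed_field poly"
  assumes "\<And>s. s \<noteq> 0 \<Longrightarrow> poly p s = 0"
  shows "p = 0"
proof (rule ccontr)
  assume "p \<noteq> 0"
  hence "finite {x. poly p x = 0}" by (rule poly_roots_finite)
  moreover have "UNIV \<subseteq> insert 0 {x. poly p x = 0}" using assms by auto
  ultimately show False using infinite_UNIV_alg_closed finite_subset by blast
qed

text \<open>Join an arbitrary \<open>x\<close> to \<open>x0\<close> by a line. On it
  \<open>P * Q\<close> vanishes identically while \<open>Q\<close> does not, so \<open>P\<close>
  vanishes along the line, in particular at \<open>x\<close>.\<close>

lemma mat_poly_density:
  fixes P Q :: "'a::alg_closed_field mat \<Rightarrow> 'a"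
  assumes P: "P \<in> mat_poly_funs n d" and Q: "Q \<in> mat_poly_funs n d"
    and x0: "Q x0 \<noteq> 0" and vanish: "\<And>x. x \<in> carrier_mat n d \<Longrightarrow> Q x \<noteq> 0 \<Longrightarrow> P x = 0"
  shows "P = 0"
proof
  fix x
  have x0C: "x0 \<in> carrier_mat n d" using x0 mat_poly_outside[OF Q] by blast
  show "P x = 0 x"
  proof (cases "x \<in> carrier_mat n d")
    case True
    define \<psi> where "\<psi> s = x + s \<cdot>\<^sub>m (x0 - x)" for s
    have C: "\<psi> s \<in> carrier_mat n d" for s
      using True x0C unfolding \<psi>_def by (intro add_carrier_mat smult_carrier_mat minus_carrier_mat)
    have entries: "\<exists>p. \<forall>s. \<psi> s $$ (i, j) = poly p s" if "i < n" "j < d" for i j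
      by (rule exI[of _ "[:x $$ (i, j), x0 $$ (i, j) - x $$ (i, j):]"])
         (use True x0C that in \<open>simp add: \<psi>_def\<close>)
    obtain p q where p: "\<forall>s. P (\<psi> s) = poly p s" and q: "\<forall>s. Q (\<psi> s) = poly q s"
      using mat_poly_along_curve[OF P C entries] mat_poly_along_curve[OF Q C entries] by blast
    have \<psi>01: "\<psi> 0 = x" "\<psi> 1 = x0"
      using True x0C by (auto simp: \<psi>_def intro!: eq_matI)
    have "q \<noteq> 0" using x0 q \<psi>01 by (metis poly_0)
    moreover have "poly (p * q) s = 0" for s
      using vanish[OF C, of s] p q by auto
    ultimately have "p = 0"
      using poly_eq_0_if_infinite_roots[of "p * q"] by auto
    thus ?thesis using p \<psi>01 by (metis poly_0 zero_fun_apply)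
  qed (simp add: mat_poly_outside[OF P])
qed

section \<open>The general linear group and its big cell\<close>

lemma carrier_GL: "carrier (GL m) = {x \<in> carrier_mat m m. det (x :: 'a::field mat) \<noteq> 0}"
proof -
  have "carrier (GL m) = Units (ring_mat TYPE('a) m ())"
    by (simp add: GL_def units_of_def)
  moreover have "Units (ring_mat TYPE('a) m ()) \<subseteq> carrier_mat m m"
    by (auto simp: Units_def ring_mat_def)
  ultimately show ?thesis
    using unit_imp_det_non_zero[where 'a = 'a and n = m and b = "()"]
      det_non_zero_imp_unit[where 'a = 'a and n = m and b = "()"] by auto
qed

lemma GL_carrierD [simp]: "g \<in> carrier (GL m) \<Longrightarrow> g \<in> carrier_mat m m"
  unfolding carrier_GL by blast

lemma group_GL: "group (GL m)"
  unfolding GL_def by (intro monoid.units_group ring.is_monoid ring_mat)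

lemma GL_simps [simp]: "x \<otimes>\<^bsub>GL m\<^esub> y = x * y" "\<one>\<^bsub>GL m\<^esub> = 1\<^sub>m m"
  by (simp_all add: GL_def units_of_def ring_mat_def)

lemma GL_mult [simp]: "g \<in> carrier (GL m) \<Longrightarrow> h \<in> carrier (GL m) \<Longrightarrow> g * h \<in> carrier (GL m)"
  using monoid.m_closed[OF group.is_monoid[OF group_GL], of g m h] by simp

lemma GL_one [simp]: "1\<^sub>m m \<in> carrier (GL m)"
  by (simp add: carrier_GL del: GL_carrierD)

lemma GL_inv [simp]:
  assumes "g \<in> carrier (GL m)"
  shows "inv\<^bsub>GL m\<^esub> g \<in> carrier (GL m)" "inv\<^bsub>GL m\<^esub> g * g = 1\<^sub>m m" "g * inv\<^bsub>GL m\<^esub> g = 1\<^sub>m m"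
    "inv\<^bsub>GL m\<^esub> (inv\<^bsub>GL m\<^esub> g) = g"
  using group.inv_closed[OF group_GL assms] group.l_inv[OF group_GL assms]
    group.r_inv[OF group_GL assms] group.inv_inv[OF group_GL assms] unfolding GL_simps .

lemma GL_inv_mult:
  assumes "g \<in> carrier (GL m)" "h \<in> carrier (GL m)"
  shows "inv\<^bsub>GL m\<^esub> (g * h) = inv\<^bsub>GL m\<^esub> h * inv\<^bsub>GL m\<^esub> g"
  using group.inv_mult_group[OF group_GL assms] unfolding GL_simps .

definition upper_unitriangular :: "nat \<Rightarrow> 'a::field mat set" where
  "upper_unitriangular m = {u \<in> carrier_mat m m.
     (\<forall>i<m. u $$ (i, i) = 1) \<and> (\<forall>i<m. \<forall>j<m. j < i \<longrightarrow> u $$ (i, j) = 0)}"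

lemma upper_unitriangular_GL: "u \<in> upper_unitriangular m \<Longrightarrow> u \<in> carrier (GL m)"
proof -
  assume u: "u \<in> upper_unitriangular m"
  hence "det u = prod_list (diag_mat u)"
    by (intro det_upper_triangular[of _ m]) (auto simp: upper_unitriangular_def)
  also have "\<dots> = 1"
    using u by (auto simp: upper_unitriangular_def prod_list_diag_prod)
  finally show ?thesis using u by (simp add: carrier_GL upper_unitriangular_def del: GL_carrierD)
qed

lemma lower_unitriangular_GL: "u \<in> lower_unitriangular m \<Longrightarrow> u \<in> carrier (GL m)"
proof -
  assume u: "u \<in> lower_unitriangular m"
  hence "det u = prod_list (diag_mat u)"
    by (intro det_lower_triangular[of m]) (auto simp: lower_unitriangular_def)
  also have "\<dots> = 1"
    using u by (auto simp: lower_unitriangular_def prod_list_diag_prod)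
  finally show ?thesis using u by (simp add: carrier_GL lower_unitriangular_def del: GL_carrierD)
qed

lemma torus_GL: "t \<in> torus m \<Longrightarrow> t \<in> carrier (GL m)"
  by (simp add: torus_def)

text \<open>Gaussian elimination without pivoting, by bordering: the leading block is factored by
  induction, the two border blocks are solved for, and the corner is adjusted.\<close>

lemma LDU_decomposition:
  fixes x :: "'a::field mat"
  assumes "x \<in> carrier_mat m m" and "\<And>k. k \<le> m \<Longrightarrow> det (first_columns k x) \<noteq> 0"
  shows "\<exists>l\<in>lower_unitriangular m. \<exists>t\<in>torus m. \<exists>u\<in>upper_unitriangular m. x = l * t * u"
  using assms
proof (induction m arbitrary: x)
  case 0
  have "x = 1\<^sub>m 0" using 0 by auto
  thus ?case
    by (intro bexI[of _ "1\<^sub>m 0"])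
       (auto simp: lower_unitriangular_def torus_def upper_unitriangular_def carrier_GL diagonal_mat_def simp del: GL_carrierD)
next
  case (Suc m)
  define A where "A = first_columns m x"
  define b where "b = mat m 1 (\<lambda>(i, j). x $$ (i, m))"
  define c where "c = mat 1 m (\<lambda>(i, j). x $$ (m, j))"
  define e where "e = mat 1 1 (\<lambda>(i, j). x $$ (m, m))"
  have x: "x = four_block_mat A b c e"
    using Suc.prems(1) by (auto simp: A_def b_def c_def e_def first_columns_def less_Suc_eq intro!: eq_matI)
  have C: "A \<in> carrier_mat m m" "b \<in> carrier_mat m 1" "c \<in> carrier_mat 1 m" "e \<in> carrier_mat 1 1"
    by (auto simp: A_def b_def c_def e_def)
  have "first_columns k A = first_columns k x" if "k \<le> m" for k
    using that by (auto simp: A_def first_columns_def intro!: eq_matI)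
  then obtain l t u where l: "l \<in> lower_unitriangular m" and t: "t \<in> torus m"
    and u: "u \<in> upper_unitriangular m" and A: "A = l * t * u"
    using Suc.IH[of A] Suc.prems(2) C by (metis le_SucI)
  note ltu = lower_unitriangular_GL[OF l] torus_GL[OF t] upper_unitriangular_GL[OF u]
  define lt where "lt = l * t"
  define tu where "tu = t * u"
  have G: "lt \<in> carrier (GL m)" "tu \<in> carrier (GL m)" using ltu by (simp_all add: lt_def tu_def)
  note ltuC = ltu[THEN GL_carrierD] G[THEN GL_carrierD] GL_inv(1)[THEN GL_carrierD, OF G(1)] GL_inv(1)[THEN GL_carrierD, OF G(2)]
  \<comment> \<open>\<open>b'\<close> and \<open>c'\<close> solve \<open>lt * b' = b\<close> and
    \<open>c' * tu = c\<close>. The corner \<open>e'\<close> is the Schur complement of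
    \<open>A\<close>, since \<open>c' * t * b'\<close> equals \<open>c\<close> times the inverse of
    \<open>A\<close> times \<open>b\<close>.\<close>
  define b' where "b' = inv\<^bsub>GL m\<^esub> lt * b"
  define c' where "c' = c * inv\<^bsub>GL m\<^esub> tu"
  define e' where "e' = e - c' * t * b'"
  have C': "b' \<in> carrier_mat m 1" "c' \<in> carrier_mat 1 m" "e' \<in> carrier_mat 1 1"
    using C ltuC by (auto simp: b'_def c'_def e'_def intro!: minus_carrier_mat mult_carrier_mat)
  define L where "L = four_block_mat l (0\<^sub>m m 1) c' (1\<^sub>m 1)"
  define T where "T = four_block_mat t (0\<^sub>m m 1) (0\<^sub>m 1 m) e'"
  define V where "V = four_block_mat u b' (0\<^sub>m 1 m) (1\<^sub>m 1)"
  have "L * T = four_block_mat lt (0\<^sub>m m 1) (c' * t) e'"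
    unfolding L_def T_def lt_def using ltuC C'
    by (subst mult_four_block_mat[of _ m m _ 1 _ 1]) auto
  hence "L * T * V = four_block_mat (lt * u) (lt * b') (c' * t * u) (c' * t * b' + e')"
    unfolding V_def using ltuC C'
    by (simp add: mult_four_block_mat[of _ m m _ 1 _ 1])
  also have "lt * b' = b"
    unfolding b'_def using C G
    by (simp add: assoc_mult_mat[OF ltuC(4) ltuC(6) C(2), symmetric])
  also have "c' * t * u = c"
  proof -
    have "c' * t * u = c' * tu" using ltuC C' by (simp add: tu_def)
    also have "\<dots> = c * (inv\<^bsub>GL m\<^esub> tu * tu)" unfolding c'_def using ltuC C by simp
    finally show ?thesis using G C by simp
  qed
  also have "c' * t * b' + e' = e"
  proof -
    have "X + (e - X) = e" if "X \<in> carrier_mat 1 1" for X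
      using that C(4) by (intro eq_matI) auto
    moreover have "c' * t * b' \<in> carrier_mat 1 1" using ltuC C' by (intro mult_carrier_mat)
    ultimately show ?thesis by (simp add: e'_def)
  qed
  also have "four_block_mat (lt * u) b c e = x" by (simp add: x A lt_def)
  finally have x_LTV: "x = L * T * V" ..
  have LC: "L \<in> lower_unitriangular (Suc m)"
    using l C' unfolding lower_unitriangular_def L_def by (auto simp: less_Suc_eq)
  have VC: "V \<in> upper_unitriangular (Suc m)"
    using u C' unfolding upper_unitriangular_def V_def by (auto simp: less_Suc_eq)
  have TC: "T \<in> carrier_mat (Suc m) (Suc m)" using C' ltuC unfolding T_def by auto
  \<comment> \<open>The largest leading minor is \<open>det x\<close>; it forces
    \<open>det T \<noteq> 0\<close>, so that the diagonal matrix \<open>T\<close> lies in the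
    torus.\<close>
  have "x = first_columns (Suc m) x"
    using Suc.prems(1) by (auto simp: first_columns_def intro!: eq_matI)
  hence "det x \<noteq> 0" using Suc.prems(2)[of "Suc m"] by simp
  moreover have "det x = det L * det T * det V"
    unfolding x_LTV using TC LC[THEN lower_unitriangular_GL, THEN GL_carrierD]
      VC[THEN upper_unitriangular_GL, THEN GL_carrierD]
    by (simp add: det_mult[of _ "Suc m"])
  moreover have "dim_row t = m" "dim_col t = m" using ltuC(2) by auto
  hence "diagonal_mat T"
    using t C' unfolding diagonal_mat_def T_def torus_def by (auto simp: less_Suc_eq)
  ultimately have "T \<in> torus (Suc m)" using TC by (auto simp: torus_def carrier_GL simp del: GL_carrierD)
  thus ?case using LC VC x_LTV by blast
qed

text \<open>By \<open>LDU_decomposition\<close> the cell contains the open set on which all leading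
  minors are nonzero, and this set contains the identity.\<close>

lemma big_cell_dense:
  fixes P :: "'a::alg_closed_field mat \<Rightarrow> 'a"
  assumes P: "P \<in> mat_poly_funs m m"
    and vanish: "\<And>l t u. l \<in> lower_unitriangular m \<Longrightarrow> t \<in> torus m \<Longrightarrow> u \<in> upper_unitriangular m \<Longrightarrow>
      P (l * t * u) = 0"
  shows "P = 0"
proof (rule mat_poly_density[OF P])
  let ?Q = "fun_on (carrier_mat m m) (\<lambda>x::'a mat. \<Prod>k\<in>{..m}. det (first_columns k x))"
  show "?Q \<in> mat_poly_funs m m"
    by (intro mat_poly_on_prod mat_poly_leading_minor) auto
  have "first_columns k (1\<^sub>m m :: 'a mat) = 1\<^sub>m k" if "k \<le> m" for k
    using that by (auto simp: first_columns_def intro!: eq_matI)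
  thus "?Q (1\<^sub>m m) \<noteq> 0" by simp
  fix x :: "'a mat" assume "x \<in> carrier_mat m m" "?Q x \<noteq> 0"
  thus "P x = 0" using LDU_decomposition[of x m] vanish by auto
qed

section \<open>Regular functions on the general linear group\<close>

lemma GL_regular_add:
  assumes "f \<in> GL_regular_funs m" "g \<in> GL_regular_funs m"
  shows "f + g \<in> GL_regular_funs m"
proof -
  obtain F r where F: "f = fun_on (carrier (GL m)) (\<lambda>x. F x / det x ^ r)" "F \<in> mat_poly_funs m m"
    using assms by (auto simp: GL_regular_funs_def)
  obtain G s where G: "g = fun_on (carrier (GL m)) (\<lambda>x. G x / det x ^ s)" "G \<in> mat_poly_funs m m"
    using assms by (auto simp: GL_regular_funs_def)
  \<comment> \<open>\<open>?d r\<close> is the \<open>r\<close>th power of the determinant, written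
    as a product to fit \<open>mat_poly_on_prod\<close>; it brings both fractions to the denominator
    \<open>det x ^ (r + s)\<close>.\<close>
  let ?d = "\<lambda>r. fun_on (carrier_mat m m) (\<lambda>x. \<Prod>i<r. det x)"
  have d: "?d r \<in> mat_poly_funs m m" for r :: nat
    by (intro mat_poly_on_prod mat_poly_det)
  have "f + g = fun_on (carrier (GL m)) (\<lambda>x. (F * ?d s + G * ?d r) x / det x ^ (r + s))"
    by (auto simp: F G fun_on_def fun_eq_iff carrier_GL field_simps power_add simp del: GL_carrierD)
  moreover have "F * ?d s + G * ?d r \<in> mat_poly_funs m m"
    by (intro mat_poly_add mat_poly_mult F G d)
  ultimately show ?thesis unfolding GL_regular_funs_def by blast
qed

lemma GL_regular_mult:
  assumes "f \<in> GL_regular_funs m" "g \<in> GL_regular_funs m"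
  shows "f * g \<in> GL_regular_funs m"
proof -
  obtain F r where F: "f = fun_on (carrier (GL m)) (\<lambda>x. F x / det x ^ r)" "F \<in> mat_poly_funs m m"
    using assms by (auto simp: GL_regular_funs_def)
  obtain G s where G: "g = fun_on (carrier (GL m)) (\<lambda>x. G x / det x ^ s)" "G \<in> mat_poly_funs m m"
    using assms by (auto simp: GL_regular_funs_def)
  have "f * g = fun_on (carrier (GL m)) (\<lambda>x. (F * G) x / det x ^ (r + s))"
    by (auto simp: F G fun_on_def fun_eq_iff power_add)
  thus ?thesis using F G mat_poly_mult unfolding GL_regular_funs_def by blast
qed

text \<open>Cramer's rule: cancel \<open>g\<close> in
  \<open>g * adj_mat g = det g \<cdot>\<^sub>m 1\<^sub>m m\<close>.\<close>

lemma GL_inv_entry: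
  assumes g: "g \<in> carrier (GL m)" and ij: "i < m" "j < m"
  shows "(inv\<^bsub>GL m\<^esub> g) $$ (i, j) = adj_mat g $$ (i, j) / det g"
proof -
  have gC: "g \<in> carrier_mat m m" "det g \<noteq> 0" using g by (auto simp: carrier_GL simp del: GL_carrierD)
  note adj = adj_mat[OF gC(1)]
  have iC: "inv\<^bsub>GL m\<^esub> g \<in> carrier_mat m m" using g by simp
  have "adj_mat g = inv\<^bsub>GL m\<^esub> g * g * adj_mat g" using g adj by simp
  also have "\<dots> = inv\<^bsub>GL m\<^esub> g * (det g \<cdot>\<^sub>m 1\<^sub>m m)" using adj gC iC by (simp add: assoc_mult_mat[of _ m m _ m _ m])
  also have "\<dots> = det g \<cdot>\<^sub>m inv\<^bsub>GL m\<^esub> g"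
    using iC mult_smult_distrib[of "inv\<^bsub>GL m\<^esub> g" m m "1\<^sub>m m" m] by simp
  finally have "adj_mat g $$ (i, j) = (det g \<cdot>\<^sub>m inv\<^bsub>GL m\<^esub> g) $$ (i, j)" by simp
  thus ?thesis using gC iC ij by simp
qed

text \<open>Inversion converts a matrix coefficient that transforms under left multiplication into a
  regular function that transforms under right translation, the form required by
  \<open>Y_module\<close>.\<close>

lemma GL_regular_inv:
  assumes "P \<in> mat_poly_funs m m"
  shows "fun_on (carrier (GL m)) (\<lambda>g. P (inv\<^bsub>GL m\<^esub> g)) \<in> GL_regular_funs m"
  using assms
proof (induction rule: mat_poly_funs_induct)
  case (const c)
  have "fun_on (carrier (GL m)) (\<lambda>g. fun_on (carrier_mat m m) (\<lambda>_. c) (inv\<^bsub>GL m\<^esub> g)) =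
      fun_on (carrier (GL m)) (\<lambda>x. fun_on (carrier_mat m m) (\<lambda>_. c) x / det x ^ 0)"
    by (intro fun_on_cong) simp
  then show ?case using mat_poly_const unfolding GL_regular_funs_def by blast
next
  case (entry i j)
  let ?F = "fun_on (carrier_mat m m) (\<lambda>x. adj_mat x $$ (i, j))"
  have "fun_on (carrier (GL m)) (\<lambda>g. fun_on (carrier_mat m m) (\<lambda>x. x $$ (i, j)) (inv\<^bsub>GL m\<^esub> g)) =
      fun_on (carrier (GL m)) (\<lambda>x. ?F x / det x ^ 1)"
    using entry by (intro fun_on_cong) (simp add: GL_inv_entry)
  moreover have "?F \<in> mat_poly_funs m m"
    using mat_poly_map_adj_mat[of m] entry by (auto simp: mat_poly_map_def)
  ultimately show ?case unfolding GL_regular_funs_def by blast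
next
  case (add F G)
  then show ?case unfolding plus_fun_apply by (subst fun_on_add) (intro GL_regular_add)
next
  case (mult F G)
  then show ?case unfolding times_fun_apply by (subst fun_on_mult) (intro GL_regular_mult)
qed

section \<open>Right translation of polynomial functions\<close>

abbreviation ract :: "nat \<Rightarrow> nat \<Rightarrow> 'a::field mat \<Rightarrow> ('a mat \<Rightarrow> 'a) \<Rightarrow> 'a mat \<Rightarrow> 'a" where
  "ract n d \<equiv> right_transl (carrier_mat n d)"

lemma fscale_apply: "fscale c f x = c * f x"
  by (simp add: fscale_def)

lemma ract_apply [simp]:
  "x \<in> carrier_mat n d \<Longrightarrow> ract n d g F x = F (x * g)"
  "x \<notin> carrier_mat n d \<Longrightarrow> ract n d g F x = 0"
  by (simp_all add: right_transl_def)

lemma ract_add: "ract n d g (F + G) = ract n d g F + ract n d g G"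
  and ract_diff: "ract n d g (F - G) = ract n d g F - ract n d g G"
  and ract_times: "ract n d g (F * G) = ract n d g F * ract n d g G"
  and ract_scale: "ract n d g (fscale c F) = fscale c (ract n d g F)"
  by (auto simp: right_transl_def fun_on_def fun_eq_iff fscale_apply)

lemma ract_ract:
  assumes "g \<in> carrier_mat d d" "h \<in> carrier_mat d d"
  shows "ract n d g (ract n d h F) = ract n d (g * h) F"
  using assms by (auto simp: right_transl_def fun_on_def fun_eq_iff assoc_mult_mat[of _ n d _ d _ d])

lemma ract_one: "F \<in> mat_poly_funs n d \<Longrightarrow> ract n d (1\<^sub>m d) F = F"
  by (auto simp: right_transl_def fun_on_def fun_eq_iff mat_poly_outside)

lemma ract_mat_poly:
  assumes "F \<in> mat_poly_funs n d" "g \<in> carrier_mat d d"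
  shows "ract n d g F \<in> mat_poly_funs n d"
  unfolding right_transl_def
  by (intro mat_poly_compose[OF assms(1)] mat_poly_map_mult[OF mat_poly_map_id] mat_poly_map_const assms)

text \<open>The families \<open>g \<mapsto> \<Sum>\<^sub>k P\<^sub>k(g) Q\<^sub>k\<close> express that \<open>GL\<^sub>d\<close> acts rationally: the coaction of \<open>F\<close> has
  this form.\<close>

inductive_set poly_families :: "nat \<Rightarrow> nat \<Rightarrow> ('a::field mat \<Rightarrow> 'a mat \<Rightarrow> 'a) set" for n d where
  pure: "P \<in> mat_poly_funs d d \<Longrightarrow> Q \<in> mat_poly_funs n d \<Longrightarrow> (\<lambda>g. fscale (P g) Q) \<in> poly_families n d"
| add: "W \<in> poly_families n d \<Longrightarrow> W' \<in> poly_families n d \<Longrightarrow> (\<lambda>g. W g + W' g) \<in> poly_families n d"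

lemma poly_families_sum:
  fixes K :: nat
  assumes "\<And>k. k < K \<Longrightarrow> W k \<in> poly_families n d"
  shows "(\<lambda>g. \<Sum>k<K. W k g) \<in> poly_families n d"
  using assms
proof (induction K)
  case 0
  have "(\<lambda>g. \<Sum>k<0. W k g) = (\<lambda>g. fscale (fun_on (carrier_mat d d) (\<lambda>_. 0) g) 0)"
    by (auto simp: fun_eq_iff fscale_apply)
  then show ?case by (simp only:) (intro poly_families.pure mat_poly_const mat_poly_zero)
next
  case (Suc K)
  then show ?case by (subst sum.lessThan_Suc) (intro poly_families.add, auto)
qed

lemma poly_families_mult:
  assumes "W \<in> poly_families n d" "W' \<in> poly_families n d"
  shows "(\<lambda>g. W g * W' g) \<in> poly_families n d"
  using assms(1)
proof induction
  case (pure P Q)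
  show ?case using assms(2)
  proof induction
    case (pure P' Q')
    have "(\<lambda>g. fscale (P g) Q * fscale (P' g) Q') = (\<lambda>g. fscale ((P * P') g) (Q * Q'))"
      by (auto simp: fun_eq_iff fscale_apply)
    then show ?case
      by (simp only:) (intro poly_families.pure mat_poly_mult pure \<open>P \<in> _\<close> \<open>Q \<in> _\<close>)
  next
    case (add V V')
    then show ?case unfolding distrib_left by (intro poly_families.add)
  qed
next
  case (add V V')
  then show ?case unfolding distrib_right by (intro poly_families.add)
qed

text \<open>Translation is an algebra homomorphism in \<open>F\<close>, so only the coordinate
  functions need a computation: entry \<open>(i, j)\<close> of \<open>x * g\<close> is the sum of
  \<open>g $$ (k, j) * x $$ (i, k)\<close> over \<open>k\<close>.\<close>

lemma ract_poly_family:
  assumes "F \<in> mat_poly_funs n d"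
  shows "\<exists>W\<in>poly_families n d. \<forall>g\<in>carrier_mat d d. ract n d g F = W g"
  using assms
proof (induction rule: mat_poly_funs_induct)
  case (const c)
  let ?W = "\<lambda>g. fscale (fun_on (carrier_mat d d) (\<lambda>_. 1) g) (fun_on (carrier_mat n d) (\<lambda>_. c))"
  show ?case
  proof (rule bexI[of _ ?W], intro ballI ext)
    show "?W \<in> poly_families n d" by (intro poly_families.pure mat_poly_const)
    fix g x :: "'a mat" assume "g \<in> carrier_mat d d"
    thus "ract n d g (fun_on (carrier_mat n d) (\<lambda>_. c)) x = ?W g x"
      by (cases "x \<in> carrier_mat n d") (auto simp: fscale_apply)
  qed
next
  case (entry i j)
  let ?W = "\<lambda>K g. \<Sum>k<K. fscale (fun_on (carrier_mat d d) (\<lambda>g. g $$ (k, j)) g)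
      (fun_on (carrier_mat n d) (\<lambda>x. x $$ (i, k)))"
  show ?case
  proof (rule bexI[of _ "?W d"], intro ballI ext)
    show "?W d \<in> poly_families n d"
      by (intro poly_families_sum poly_families.pure mat_poly_entry) (use entry in auto)
    fix g x :: "'a mat" assume g: "g \<in> carrier_mat d d"
    have sum_apply: "(\<Sum>k<K. f k) x = (\<Sum>k<K. f k x)" for f :: "nat \<Rightarrow> 'a mat \<Rightarrow> 'a" and K :: nat
      by (induction K) auto
    show "ract n d g (fun_on (carrier_mat n d) (\<lambda>x. x $$ (i, j))) x = ?W d g x"
    proof (cases "x \<in> carrier_mat n d")
      case True
      hence "x * g \<in> carrier_mat n d" using g by simp
      moreover have "(x * g) $$ (i, j) = (\<Sum>k<d. g $$ (k, j) * x $$ (i, k))"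
        using True g entry by (auto simp: scalar_prod_def atLeast0LessThan mult.commute)
      ultimately show ?thesis using True g by (simp add: sum_apply fscale_apply)
    qed (simp add: sum_apply fscale_apply)
  qed
next
  case (add F G)
  then obtain V W where VW: "V \<in> poly_families n d" "W \<in> poly_families n d"
    "\<And>g. g \<in> carrier_mat d d \<Longrightarrow> ract n d g F = V g"
    "\<And>g. g \<in> carrier_mat d d \<Longrightarrow> ract n d g G = W g" by blast
  then show ?case by (intro bexI[OF _ poly_families.add[OF VW(1,2)]]) (intro ballI, simp only: VW ract_add)
next
  case (mult F G)
  then obtain V W where VW: "V \<in> poly_families n d" "W \<in> poly_families n d"
    "\<And>g. g \<in> carrier_mat d d \<Longrightarrow> ract n d g F = V g"
    "\<And>g. g \<in> carrier_mat d d \<Longrightarrow> ract n d g G = W g" by blast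
  then show ?case by (intro bexI[OF _ poly_families_mult[OF VW(1,2)]]) (intro ballI, simp only: VW ract_times)
qed

section \<open>Linear functionals and matrix coefficients\<close>

interpretation functional: vector_space_pair fscale "(*) :: 'a::field \<Rightarrow> 'a \<Rightarrow> 'a"
  by unfold_locales (simp_all add: algebra_simps)

abbreviation functional :: "(('x \<Rightarrow> 'a::field) \<Rightarrow> 'a) \<Rightarrow> bool" where
  "functional \<equiv> Vector_Spaces.linear fscale (*)"

lemma functionalD:
  assumes "functional \<epsilon>"
  shows "\<epsilon> (v + w) = \<epsilon> v + \<epsilon> w" "\<epsilon> (v - w) = \<epsilon> v - \<epsilon> w" "\<epsilon> (fscale c v) = c * \<epsilon> v" "\<epsilon> 0 = 0"
  using functional.linear_add[OF assms] functional.linear_diff[OF assms]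
    functional.linear_scale[OF assms] functional.linear_0[OF assms] by auto

text \<open>Apply \<open>\<epsilon>\<close> to the second factors of the coaction: a term
  \<open>fscale (P g) Q\<close> becomes \<open>P g * \<epsilon> Q\<close>.\<close>

lemma matrix_coefficient_poly:
  assumes "F \<in> mat_poly_funs n d" and \<epsilon>: "functional \<epsilon>"
  shows "\<exists>p\<in>mat_poly_funs d d. \<forall>g\<in>carrier_mat d d. \<epsilon> (ract n d g F) = p g"
proof -
  have "\<exists>p\<in>mat_poly_funs d d. \<forall>g\<in>carrier_mat d d. \<epsilon> (W g) = p g" if "W \<in> poly_families n d" for W
    using that
  proof induction
    case (pure P Q)
    let ?p = "fun_on (carrier_mat d d) (\<lambda>_. \<epsilon> Q) * P"
    show ?case
    proof (intro bexI[of _ ?p] ballI)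
      show "?p \<in> mat_poly_funs d d" by (intro mat_poly_mult mat_poly_const pure)
      fix g :: "'a mat" assume "g \<in> carrier_mat d d"
      thus "\<epsilon> (fscale (P g) Q) = ?p g" by (simp add: functionalD[OF \<epsilon>])
    qed
  next
    case (add V W)
    then obtain p q where "p \<in> mat_poly_funs d d" "\<forall>g\<in>carrier_mat d d. \<epsilon> (V g) = p g"
      "q \<in> mat_poly_funs d d" "\<forall>g\<in>carrier_mat d d. \<epsilon> (W g) = q g" by blast
    note pq = this
    show ?case
    proof (intro bexI[of _ "p + q"] mat_poly_add ballI pq)
      fix g :: "'a mat" assume "g \<in> carrier_mat d d"
      then show "\<epsilon> (V g + W g) = (p + q) g"
        by (subst functionalD(1)[OF \<epsilon>]) (simp add: pq)
    qed
  qed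
  moreover obtain W where "W \<in> poly_families n d" "\<forall>g\<in>carrier_mat d d. ract n d g F = W g"
    using ract_poly_family[OF assms(1)] by auto
  ultimately show ?thesis by simp
qed

text \<open>Local finiteness of the action: the finitely many second factors \<open>Q\<close> of the
  coaction span a space that contains the whole orbit.\<close>

lemma orbit_finite_dimensional:
  assumes "F \<in> mat_poly_funs n d"
  shows "\<exists>S\<subseteq>mat_poly_funs n d. finite S \<and> (\<forall>g\<in>carrier_mat d d. ract n d g F \<in> fun_space.span S)"
proof -
  have "\<exists>S\<subseteq>mat_poly_funs n d. finite S \<and> (\<forall>g. W g \<in> fun_space.span S)" if "W \<in> poly_families n d" for W
    using that
  proof induction
    case (pure P Q)
    have "fscale (P g) Q \<in> fun_space.span {Q}" for g
      by (intro fun_space.span_scale fun_space.span_base) simp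
    then show ?case using pure by (intro exI[of _ "{Q}"] conjI allI) auto
  next
    case (add V W)
    then obtain S T where "S \<subseteq> mat_poly_funs n d" "finite S" "\<forall>g. V g \<in> fun_space.span S"
      "T \<subseteq> mat_poly_funs n d" "finite T" "\<forall>g. W g \<in> fun_space.span T" by blast
    note ST = this
    have "V g + W g \<in> fun_space.span (S \<union> T)" for g
      using ST fun_space.span_mono[of S "S \<union> T"] fun_space.span_mono[of T "S \<union> T"]
      by (intro fun_space.span_add) auto
    thus ?case using ST by (intro exI[of _ "S \<union> T"] conjI allI) (simp_all only: Un_least finite_UnI)
  qed
  moreover obtain W where "W \<in> poly_families n d" "\<forall>g\<in>carrier_mat d d. ract n d g F = W g"
    using ract_poly_family[OF assms] by auto
  ultimately show ?thesis by metis
qed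

text \<open>On \<open>S + W\<close> the rule sending \<open>v + w\<close> to
  \<open>\<epsilon> v\<close> is well defined because \<open>\<epsilon>\<close> kills the
  intersection; a basis of the sum then carries it to the whole space. Since
  \<open>\<epsilon>\<close> is linear only on \<open>S\<close>, totality has to be restored before
  matrix coefficients can be formed.\<close>

lemma functional_extension:
  assumes S: "fun_space.subspace S" and W: "fun_space.subspace W"
    and add: "\<And>v w. v \<in> S \<Longrightarrow> w \<in> S \<Longrightarrow> \<epsilon> (v + w) = \<epsilon> v + \<epsilon> w"
    and scale: "\<And>c v. v \<in> S \<Longrightarrow> \<epsilon> (fscale c v) = c * \<epsilon> v"
    and zero: "\<And>v. v \<in> S \<Longrightarrow> v \<in> W \<Longrightarrow> \<epsilon> v = 0"
  shows "\<exists>\<epsilon>'. functional \<epsilon>' \<and> (\<forall>v\<in>S. \<epsilon>' v = \<epsilon> v) \<and> (\<forall>w\<in>W. \<epsilon>' w = (0 :: 'a::field))"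
proof -
  note sub = fun_space.subspace_add fun_space.subspace_diff fun_space.subspace_scale fun_space.subspace_0
  define X where "X = {v + w | v w. v \<in> S \<and> w \<in> W}"
  define \<eta> where "\<eta> x = (SOME a. \<exists>v\<in>S. \<exists>w\<in>W. x = v + w \<and> a = \<epsilon> v)" for x
  have eta: "\<eta> (v + w) = \<epsilon> v" if vw: "v \<in> S" "w \<in> W" for v w
  proof -
    have "\<exists>v'\<in>S. \<exists>w'\<in>W. v + w = v' + w' \<and> \<eta> (v + w) = \<epsilon> v'"
      unfolding \<eta>_def by (rule someI[of _ "\<epsilon> v"]) (use vw in blast)
    then obtain v' w' where v': "v' \<in> S" "w' \<in> W" "v + w = v' + w'" "\<eta> (v + w) = \<epsilon> v'" by blast
    have "v - v' = w' - w" using v'(3) by (metis add_diff_cancel_left' add_diff_cancel_right' add_diff_eq)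
    hence "\<epsilon> (v - v') = 0" using zero[of "v - v'"] sub(2)[OF S vw(1) v'(1)] sub(2)[OF W v'(2) vw(2)] by simp
    moreover have "\<epsilon> v = \<epsilon> (v - v') + \<epsilon> v'" using add[of "v - v'" v'] sub(2)[OF S vw(1) v'(1)] v'(1) by simp
    ultimately show ?thesis using v'(4) by simp
  qed
  obtain B where B: "B \<subseteq> X" "fun_space.independent B" "X \<subseteq> fun_space.span B"
    using fun_space.maximal_independent_subset by blast
  obtain \<epsilon>' where \<epsilon>': "functional \<epsilon>'" "\<forall>x\<in>B. \<epsilon>' x = \<eta> x"
    using functional.linear_independent_extend[OF B(2)] by blast
  \<comment> \<open>Membership in \<open>X\<close> is carried through the induction, because
    \<open>\<eta>\<close> is under control only on \<open>X\<close>.\<close>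
  have "x \<in> X \<and> \<epsilon>' x = \<eta> x" if "x \<in> fun_space.span B" for x
    using that
  proof (induction rule: fun_space.span_induct_alt)
    case base
    have "\<epsilon> 0 = 0" by (rule zero) (simp_all add: sub S W)
    hence "\<eta> (0 + 0) = 0" using eta[of 0 0] sub(4)[OF S] sub(4)[OF W] by simp
    moreover have "0 + 0 \<in> X" using sub(4)[OF S] sub(4)[OF W] unfolding X_def by blast
    ultimately show ?case using functionalD(4)[OF \<epsilon>'(1)] unfolding add_0_left by (intro conjI) (assumption, metis)
  next
    case (step c x y)
    obtain v w v' w' where x: "x = v + w" "v \<in> S" "w \<in> W" and y: "y = v' + w'" "v' \<in> S" "w' \<in> W"
      using step B(1) unfolding X_def by blast
    have eq: "fscale c x + y = (fscale c v + v') + (fscale c w + w')"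
      unfolding x y fun_space.scale_right_distrib by (simp add: algebra_simps)
    have mem: "fscale c v + v' \<in> S" "fscale c w + w' \<in> W" by (intro sub x y S W)+
    have "\<epsilon>' (fscale c x + y) = c * \<eta> x + \<eta> y"
      using step \<epsilon>'(2) by (simp add: functionalD[OF \<epsilon>'(1)])
    also have "\<dots> = \<epsilon> (fscale c v + v')"
      using x y eta add[of "fscale c v" v'] scale sub(3)[OF S] by simp
    also have "\<dots> = \<eta> (fscale c x + y)" unfolding eq using eta mem by simp
    finally show ?case using eq mem unfolding X_def by blast
  qed
  hence ext: "\<epsilon>' x = \<eta> x" if "x \<in> X" for x using that B(3) by blast
  have "\<epsilon>' v = \<epsilon> v" if "v \<in> S" for v
  proof -
    have "v + 0 \<in> X" using that sub(4)[OF W] unfolding X_def by blast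
    thus ?thesis using ext[of "v + 0"] eta[of v 0] that sub(4)[OF W] by simp
  qed
  moreover have "\<epsilon>' w = 0" if "w \<in> W" for w
  proof -
    have "0 + w \<in> X" using that sub(4)[OF S] unfolding X_def by blast
    moreover have "\<epsilon> 0 = 0" by (rule zero) (simp_all add: sub S W)
    ultimately show ?thesis using ext[of "0 + w"] eta[of 0 w] that sub(4)[OF S] by simp
  qed
  ultimately show ?thesis using \<epsilon>'(1) by blast
qed

section \<open>Grading by a regular cocharacter\<close>

text \<open>With indices from \<open>0\<close> the exponents run from \<open>d\<close> down to
  \<open>1\<close>. Their strict decrease makes conjugation treat upper and lower unitriangular
  matrices in opposite ways; natural exponents keep the degrees of polynomial functions in
  \<open>nat\<close>.\<close>

definition cochar :: "nat \<Rightarrow> 'a::field \<Rightarrow> 'a mat" where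
  "cochar d s = mat_diag d (\<lambda>i. s ^ (d - i))"

lemma cochar_carrier [simp]: "cochar d s \<in> carrier_mat d d"
  by (simp add: cochar_def)

lemma dim_cochar [simp]: "dim_row (cochar d s) = d" "dim_col (cochar d s) = d"
  by (simp_all add: cochar_def mat_diag_def)

lemma cochar_torus: "s \<noteq> 0 \<Longrightarrow> cochar d s \<in> torus d"
proof -
  assume "s \<noteq> 0"
  have "det (cochar d s) = prod_list (diag_mat (cochar d s))"
    by (intro det_upper_triangular[of _ d]) (auto simp: cochar_def mat_diag_def)
  also have "\<dots> \<noteq> 0" using \<open>s \<noteq> 0\<close> by (simp add: prod_list_diag_prod cochar_def mat_diag_def)
  finally show ?thesis
    by (simp add: torus_def carrier_GL diagonal_mat_def del: GL_carrierD) (simp add: cochar_def mat_diag_def)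
qed

lemma cochar_GL: "s \<noteq> 0 \<Longrightarrow> cochar d s \<in> carrier (GL d)"
  by (intro torus_GL cochar_torus)

text \<open>Weight spaces of the cocharacter. A coordinate function of column \<open>j\<close>,
  counted from \<open>0\<close>, has degree \<open>d - j\<close>.\<close>

definition homog :: "nat \<Rightarrow> nat \<Rightarrow> nat \<Rightarrow> ('a::field mat \<Rightarrow> 'a) set" where
  "homog n d k =
     {F \<in> mat_poly_funs n d. \<forall>s. s \<noteq> 0 \<longrightarrow> ract n d (cochar d s) F = fscale (s ^ k) F}"

definition graded :: "nat \<Rightarrow> nat \<Rightarrow> nat set \<Rightarrow> ('a::field mat \<Rightarrow> 'a) set" where
  "graded n d L = fun_space.span (\<Union>k\<in>L. homog n d k)"

definition cochar_stable :: "nat \<Rightarrow> nat \<Rightarrow> ('a::field mat \<Rightarrow> 'a) set \<Rightarrow> bool" where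
  "cochar_stable n d W \<longleftrightarrow> fun_space.subspace W \<and> (\<forall>s. s \<noteq> 0 \<longrightarrow> (\<forall>v\<in>W. ract n d (cochar d s) v \<in> W))"

lemma homog_mat_poly: "F \<in> homog n d k \<Longrightarrow> F \<in> mat_poly_funs n d"
  by (simp add: homog_def)

lemma ract_zero: "ract n d g 0 = 0"
  by (auto simp: right_transl_def fun_on_def fun_eq_iff)

lemma ract_sum: "ract n d g (sum f J) = (\<Sum>i\<in>J. ract n d g (f i))"
  using sum_comp_morphism[of "ract n d g" f J] by (simp add: ract_zero ract_add o_def)

lemma subspace_homog: "fun_space.subspace (homog n d k)"
  unfolding fun_space.subspace_def homog_def
  by (auto simp: ract_add ract_scale ract_zero mat_poly_zero mat_poly_add mat_poly_scale
        fun_space.scale_right_distrib fun_space.scale_left_commute)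

lemma homog_mult:
  assumes "F \<in> homog n d k" "G \<in> homog n d l"
  shows "F * G \<in> homog n d (k + l)"
proof -
  have "fscale a F * fscale b G = fscale (a * b) (F * G)" for a b
    by (auto simp: fun_eq_iff fscale_apply)
  thus ?thesis using assms by (auto simp: homog_def ract_times mat_poly_mult power_add)
qed

lemma subspace_graded: "fun_space.subspace (graded n d L)"
  by (simp add: graded_def)

lemma graded_mono: "L \<subseteq> L' \<Longrightarrow> graded n d L \<subseteq> graded n d L'"
  unfolding graded_def by (intro fun_space.span_mono) auto

lemma homog_graded: "F \<in> homog n d k \<Longrightarrow> k \<in> L \<Longrightarrow> F \<in> graded n d L"
  unfolding graded_def by (intro fun_space.span_base) blast

text \<open>By bilinearity both factors may be taken homogeneous, one after the other, and then
  \<open>homog_mult\<close> applies.\<close>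

lemma graded_UNIV_mult:
  assumes "F \<in> graded n d UNIV" "G \<in> graded n d UNIV"
  shows "F * G \<in> graded n d UNIV"
proof -
  note sub = fun_space.subspace_0[OF subspace_graded] fun_space.subspace_add[OF subspace_graded]
    fun_space.subspace_scale[OF subspace_graded]
  have scale: "F * fscale c G = fscale c (F * G)" "fscale c G * F = fscale c (G * F)"
    for F G :: "'a mat \<Rightarrow> 'a" and c
    by (rule ext, simp only: times_fun_apply fscale_apply mult.left_commute mult.assoc)+
  note bilin = distrib_left distrib_right mult_zero_left mult_zero_right scale
  have "G \<in> {G. F * G \<in> graded n d UNIV}" if F: "F \<in> homog n d k" for F k
  proof -
    have "fun_space.subspace {G. F * G \<in> graded n d UNIV}"
      by (rule fun_space.subspaceI) (simp_all only: mem_Collect_eq bilin sub)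
    moreover have "homog n d l \<subseteq> {G. F * G \<in> graded n d UNIV}" for l
      using F by (auto intro: homog_graded homog_mult)
    ultimately show ?thesis
      using fun_space.span_minimal[of "\<Union>k. homog n d k" "{G. F * G \<in> graded n d UNIV}"] assms(2)
      unfolding graded_def[of n d UNIV] by blast
  qed
  hence "homog n d k \<subseteq> {F. F * G \<in> graded n d UNIV}" for k by blast
  moreover have "fun_space.subspace {F. F * G \<in> graded n d UNIV}"
    by (rule fun_space.subspaceI) (simp_all only: mem_Collect_eq bilin sub)
  ultimately show ?thesis
    using fun_space.span_minimal[of "\<Union>k. homog n d k" "{F. F * G \<in> graded n d UNIV}"] assms(1)
    unfolding graded_def[of n d UNIV] by blast
qed

lemma mat_poly_graded: "F \<in> mat_poly_funs n d \<Longrightarrow> F \<in> graded n d UNIV"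
proof (induction rule: mat_poly_funs_induct)
  case (const c)
  have "fun_on (carrier_mat n d) (\<lambda>_. c) \<in> homog n d 0"
    unfolding homog_def mem_Collect_eq right_transl_def
    by (intro conjI mat_poly_const) (auto simp: fun_on_def fun_eq_iff fscale_apply
          intro!: mult_carrier_mat[of _ n d])
  then show ?case by (rule homog_graded) simp
next
  case (entry i j)
  have "(x * cochar d s) $$ (i, j) = s ^ (d - j) * x $$ (i, j)" if "x \<in> carrier_mat n d" for x s
    using that entry by (simp add: cochar_def mat_diag_mult_right[OF that])
  hence "fun_on (carrier_mat n d) (\<lambda>x. x $$ (i, j)) \<in> homog n d (d - j)"
    unfolding homog_def mem_Collect_eq right_transl_def using entry
    by (intro conjI mat_poly_entry) (auto simp: fun_on_def fun_eq_iff fscale_apply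
          intro!: mult_carrier_mat[of _ n d] simp del: index_mult_mat(1))
  then show ?case by (rule homog_graded) simp
next
  case (add F G)
  show ?case by (intro fun_space.subspace_add[OF subspace_graded] add)
next
  case (mult F G)
  show ?case by (intro graded_UNIV_mult mult)
qed

text \<open>Normal form with a single component per degree; \<open>f\<close> is homogeneous at every
  index, but only the indices in \<open>I\<close> contribute.\<close>

lemma graded_sum:
  assumes "v \<in> graded n d L"
  shows "\<exists>I f. finite I \<and> I \<subseteq> L \<and> (\<forall>l. f l \<in> homog n d l) \<and> v = sum f I"
  using assms unfolding graded_def
proof (induction v rule: fun_space.span_induct_alt)
  case base
  show ?case
  proof (intro exI[of _ "{}"] exI[of _ "\<lambda>_. 0"] conjI allI)
    show "0 \<in> homog n d l" for l by (rule fun_space.subspace_0[OF subspace_homog])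
  qed simp_all
next
  case (step c x y)
  then obtain I f where f: "finite I" "I \<subseteq> L" "\<forall>l. f l \<in> homog n d l" "y = sum f I" by blast
  obtain k where k: "k \<in> L" "x \<in> homog n d k" using step by blast
  \<comment> \<open>The new term joins the component of degree \<open>k\<close>. If \<open>k\<close>
    was not yet in \<open>I\<close>, the value \<open>f k\<close> is no part of \<open>y\<close> and
    must be dropped.\<close>
  define f' where "f' l = (if l = k then fscale c x + (if k \<in> I then f k else 0) else f l)" for l
  note sub = fun_space.subspace_add[OF subspace_homog] fun_space.subspace_scale[OF subspace_homog]
    fun_space.subspace_0[OF subspace_homog]
  have "f' l \<in> homog n d l" for l
    using f(3) k(2) by (cases "l = k"; cases "k \<in> I") (auto simp: f'_def intro: sub)
  moreover have "sum f' (I - {k}) = sum f (I - {k})" by (intro sum.cong) (auto simp: f'_def)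
  hence "sum f' (insert k I) = fscale c x + (if k \<in> I then f k else 0) + sum f (I - {k})"
    using f(1) by (simp add: sum.insert_remove f'_def)
  hence "sum f' (insert k I) = fscale c x + y"
    using f(1,4) by (cases "k \<in> I") (simp_all add: sum.remove add.assoc)
  ultimately show ?case using f k by (intro exI[of _ "insert k I"] exI[of _ f']) auto
qed

section \<open>Homogeneous components of stable subspaces\<close>

lemma exists_separating_scalar:
  assumes "k \<noteq> l"
  shows "\<exists>s::'a::alg_closed_field. s \<noteq> 0 \<and> s ^ k \<noteq> s ^ l"
proof (rule ccontr)
  assume *: "\<nexists>s::'a. s \<noteq> 0 \<and> s ^ k \<noteq> s ^ l"
  have "monom (1::'a) k - monom 1 l = 0"
    by (rule poly_eq_0_if_infinite_roots) (use * in \<open>auto simp: poly_monom\<close>)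
  hence "coeff (monom (1::'a) k) k = coeff (monom 1 l) k" by simp
  thus False using assms by simp
qed

text \<open>Elimination of one degree at a time: the action of \<open>cochar d s\<close> minus
  \<open>s ^ j\<close> kills the component of degree \<open>j\<close> and multiplies that of degree
  \<open>i\<close> by \<open>s ^ i - s ^ j\<close>.\<close>

lemma component_in_stable:
  fixes W :: "('a::alg_closed_field mat \<Rightarrow> 'a) set"
  assumes W: "cochar_stable n d W"
    and "finite I" and "\<And>l. l \<in> I \<Longrightarrow> f l \<in> homog n d l" and "sum f I \<in> W" and "k \<in> I"
  shows "f k \<in> W"
  using assms(2-)
proof (induction I arbitrary: f k rule: finite_induct)
  case (insert j I)
  note sub = fun_space.subspace_diff fun_space.subspace_scale
  have sW: "fun_space.subspace W" using W by (simp add: cochar_stable_def)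
  have in_I: "f l \<in> W" if "l \<in> I" for l
  proof -
    \<comment> \<open>The scalar \<open>s\<close> is chosen for this \<open>l\<close> alone; factors
      at other degrees may vanish, which does no harm since only the component of degree
      \<open>l\<close> is recovered.\<close>
    have "l \<noteq> j" using that insert.hyps(2) by auto
    then obtain s :: 'a where s: "s \<noteq> 0" "s ^ l \<noteq> s ^ j"
      using exists_separating_scalar by metis
    let ?g = "\<lambda>i. fscale (s ^ i - s ^ j) (f i)"
    have h: "ract n d (cochar d s) (f i) = fscale (s ^ i) (f i)" if "i \<in> insert j I" for i
      using insert.prems(1)[OF that] s(1) unfolding homog_def by blast
    have "?g j = 0" by (simp only: diff_self fun_space.scale_zero_left)
    hence "sum ?g I = sum ?g (insert j I)"
      by (simp only: sum.insert[OF insert.hyps] add_0_left)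
    also have "\<dots> = (\<Sum>i\<in>insert j I. ract n d (cochar d s) (f i)) - (\<Sum>i\<in>insert j I. fscale (s ^ j) (f i))"
      unfolding sum_subtractf[symmetric]
      by (intro sum.cong refl) (simp only: h fun_space.scale_left_diff_distrib)
    also have "\<dots> = ract n d (cochar d s) (sum f (insert j I)) - fscale (s ^ j) (sum f (insert j I))"
      by (simp only: ract_sum fun_space.scale_sum_right)
    also have "\<dots> \<in> W"
      using W insert.prems(2) s(1) by (intro sub sW) (auto simp only: cochar_stable_def)
    finally have gW: "sum ?g I \<in> W" .
    have "?g l \<in> W"
    proof (rule insert.IH[OF _ gW that])
      show "?g i \<in> homog n d i" if "i \<in> I" for i
        using insert.prems(1) that by (intro fun_space.subspace_scale[OF subspace_homog]) blast
    qed
    hence "fscale (inverse (s ^ l - s ^ j)) (?g l) \<in> W" by (rule sub(2)[OF sW])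
    moreover have "fscale (inverse (s ^ l - s ^ j)) (?g l) = f l"
      by (rule ext) (use s in \<open>simp add: fscale_apply\<close>)
    ultimately show ?thesis by (simp only:)
  qed
  have "f j = sum f (insert j I) - sum f I"
    by (simp only: sum.insert[OF insert.hyps] add_diff_cancel_right')
  also have "\<dots> \<in> W"
    by (intro sub(1)[OF sW insert.prems(2)] fun_space.subspace_sum[OF sW] in_I)
  finally have "f j \<in> W" .
  thus ?case using in_I insert.prems(3) by blast
qed simp

text \<open>Allows containments to be checked degree by degree.\<close>

lemma graded_stable_subset:
  fixes W :: "('a::alg_closed_field mat \<Rightarrow> 'a) set"
  assumes W: "cochar_stable n d W" and Z: "fun_space.subspace Z"
    and sub: "\<And>l. l \<in> L \<Longrightarrow> homog n d l \<inter> W \<subseteq> Z" and v: "v \<in> graded n d L" "v \<in> W"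
  shows "v \<in> Z"
proof -
  obtain I f where f: "finite I" "I \<subseteq> L" "\<forall>l. f l \<in> homog n d l" "v = sum f I"
    using graded_sum[OF v(1)] by blast
  have "f l \<in> W" if "l \<in> I" for l
    using component_in_stable[OF W f(1), of f l] f v that by auto
  thus ?thesis unfolding f(4) using f sub by (intro fun_space.subspace_sum[OF Z]) blast
qed

text \<open>Pass to the component of degree \<open>k\<close> in \<open>b - w\<close>: as
  \<open>b\<close> is homogeneous, this is \<open>b\<close> minus the corresponding component of
  \<open>w\<close>.\<close>

lemma homogeneous_correction:
  fixes W X :: "('a::alg_closed_field mat \<Rightarrow> 'a) set"
  assumes W: "cochar_stable n d W" "W \<subseteq> mat_poly_funs n d" and X: "cochar_stable n d X"
    and b: "b \<in> homog n d k" and w: "w \<in> W" and bw: "b - w \<in> X"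
  shows "\<exists>w'\<in>W \<inter> homog n d k. b - w' \<in> X"
proof -
  obtain I f where f: "finite I" "\<forall>l. f l \<in> homog n d l" "w = sum f I"
    using graded_sum[OF mat_poly_graded, of w n d] w W(2) by blast
  define f' where "f' l = (if l \<in> I then f l else 0)" for l
  \<comment> \<open>\<open>g\<close> lists the components of \<open>b - w\<close>, with
    \<open>f'\<close> extended by \<open>0\<close> to degrees absent from \<open>w\<close>. The
    correction sought is \<open>f' k\<close>.\<close>
  define g where "g l = (if l = k then b else 0) - f' l" for l
  have f'W: "f' l \<in> W" for l
    using component_in_stable[OF W(1) f(1), of f l] f w W(1)
    by (auto simp: f'_def cochar_stable_def fun_space.subspace_0)
  have f'h: "f' l \<in> homog n d l" for l
    using f by (auto simp: f'_def fun_space.subspace_0[OF subspace_homog])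
  have gh: "g l \<in> homog n d l" for l
    unfolding g_def using b f'h
    by (intro fun_space.subspace_diff[OF subspace_homog]) (auto simp: fun_space.subspace_0[OF subspace_homog])
  have "sum f' (insert k I) = w"
    unfolding f(3) using f(1) by (cases "k \<in> I") (auto simp: f'_def insert_absorb intro!: sum.cong)
  hence "sum g (insert k I) = b - w"
    unfolding g_def sum_subtractf using f(1) by simp
  hence "g k \<in> X"
    using component_in_stable[OF X, of "insert k I" g k] gh bw f(1) by simp
  thus ?thesis using f'W f'h by (auto simp: g_def)
qed

section \<open>Effect of torus and unipotent elements on degrees\<close>

lemma ract_torus_homog:
  assumes v: "v \<in> homog n d k" and t: "t \<in> torus d"
  shows "ract n d t v \<in> homog n d k"
proof -
  have tC: "t \<in> carrier_mat d d" using t by (simp add: torus_GL)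
  have dims: "dim_row t = d" "dim_col t = d" using tC by auto
  have "t = mat_diag d (\<lambda>i. t $$ (i, i))"
    using t dims by (auto simp: mat_diag_def torus_def diagonal_mat_def intro!: eq_matI)
  then obtain a where "t = mat_diag d a" by blast
  hence comm: "cochar d s * t = t * cochar d s" for s
    by (simp add: cochar_def mult.commute)
  have "ract n d (cochar d s) (ract n d t v) = fscale (s ^ k) (ract n d t v)" if "s \<noteq> 0" for s
  proof -
    have "ract n d (cochar d s) (ract n d t v) = ract n d t (ract n d (cochar d s) v)"
      using tC by (simp add: ract_ract comm)
    thus ?thesis using v that by (simp add: homog_def ract_scale)
  qed
  thus ?thesis using v tC by (simp add: homog_def ract_mat_poly)
qed

text \<open>Conjugating \<open>u\<close> by \<open>cochar d s\<close> gives \<open>M s\<close>,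
  polynomial in \<open>s\<close> with \<open>M 0\<close> the identity. Hence
  \<open>w (x * cochar d s)\<close> is \<open>s ^ k * (v (x * M s) - v x)\<close>, which is
  divisible by the power \<open>k + 1\<close> of \<open>s\<close>; its coefficients are the
  components of \<open>w\<close> at \<open>x\<close>.\<close>

lemma ract_upper_unitriangular:
  fixes v :: "'a::alg_closed_field mat \<Rightarrow> 'a"
  assumes v: "v \<in> homog n d k" and u: "u \<in> upper_unitriangular d"
  shows "ract n d u v - v \<in> graded n d {k<..}"
proof -
  define w where "w = ract n d u v - v"
  note vR = homog_mat_poly[OF v]
  have uC: "u \<in> carrier_mat d d" using u by (simp add: upper_unitriangular_def)
  have "w \<in> mat_poly_funs n d" unfolding w_def by (intro mat_poly_diff ract_mat_poly vR uC)
  then obtain I f where f: "finite I" "\<forall>l. f l \<in> homog n d l" "w = sum f I"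
    using graded_sum[OF mat_poly_graded] by blast
  \<comment> \<open>The conjugate is written without inverses, so that it also makes sense at
    \<open>s = 0\<close>.\<close>
  define M where "M s = mat d d (\<lambda>(i, j). if i \<le> j then u $$ (i, j) * s ^ (j - i) else 0)" for s
  have MC: "M s \<in> carrier_mat d d" for s by (simp add: M_def)
  have comm: "cochar d s * u = M s * cochar d s" for s
  proof (rule eq_matI)
    fix i j assume "i < dim_row (M s * cochar d s)" "j < dim_col (M s * cochar d s)"
    hence ij: "i < d" "j < d" using MC[of s] cochar_carrier[of d s] by auto
    show "(cochar d s * u) $$ (i, j) = (M s * cochar d s) $$ (i, j)"
    proof (cases "i \<le> j")
      case True
      hence "s ^ (d - i) = s ^ (j - i) * s ^ (d - j)" using ij by (simp flip: power_add)
      thus ?thesis using ij True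
        by (simp add: cochar_def mat_diag_mult_left[OF uC] mat_diag_mult_right[OF MC]) (simp add: M_def)
    next
      case False
      thus ?thesis using ij u
        by (simp add: cochar_def mat_diag_mult_left[OF uC] mat_diag_mult_right[OF MC])
           (simp add: M_def upper_unitriangular_def)
    qed
  qed (use uC MC[of s] in auto)
  have M0: "M 0 = 1\<^sub>m d"
    using u by (auto simp: M_def upper_unitriangular_def intro!: eq_matI)
  have "f l x = 0" if l: "l \<in> I" "l \<le> k" and x: "x \<in> carrier_mat n d" for l x
  proof -
    have "\<exists>q. \<forall>s. v (x * M s) = poly q s"
    proof (rule mat_poly_along_curve[OF vR])
      show "x * M s \<in> carrier_mat n d" for s using x MC by simp
      fix i j assume ij: "i < n" "j < d"
      have "(x * M s) $$ (i, j) = poly (\<Sum>m<d. monom (x $$ (i, m) * (if m \<le> j then u $$ (m, j) else 0)) (j - m)) s" for s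
      proof -
        have "(x * M s) $$ (i, j) = (\<Sum>m<d. x $$ (i, m) * M s $$ (m, j))"
          using x MC[of s] ij by (auto simp: scalar_prod_def atLeast0LessThan)
        also have "\<dots> = (\<Sum>m<d. poly (monom (x $$ (i, m) * (if m \<le> j then u $$ (m, j) else 0)) (j - m)) s)"
          using ij by (intro sum.cong) (auto simp: M_def poly_monom)
        finally show ?thesis by (simp add: poly_sum)
      qed
      thus "\<exists>p. \<forall>s. (x * M s) $$ (i, j) = poly p s" by blast
    qed
    then obtain q where q: "\<And>s. v (x * M s) = poly q s" by blast
    have q0: "coeff q 0 = v x" using q[of 0] x by (simp add: M0 poly_0_coeff_0)
    define p where "p = (\<Sum>l\<in>I. monom (f l x) l)"
    have sum_apply: "sum f J y = (\<Sum>l\<in>J. f l y)" if "finite J" for J y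
      using that by (induction J) auto
    have "poly (p - monom 1 k * (q - [:v x:])) s = 0" if s: "s \<noteq> 0" for s
    proof -
      have xc: "x * cochar d s \<in> carrier_mat n d" using x by simp
      have homog: "F (y * cochar d s) = s ^ j * F y" if "F \<in> homog n d j" "y \<in> carrier_mat n d" for F y j
      proof -
        have "ract n d (cochar d s) F y = fscale (s ^ j) F y" using that s by (simp add: homog_def)
        thus ?thesis using that by (simp add: fscale_apply)
      qed
      have "poly p s = (\<Sum>l\<in>I. f l (x * cochar d s))"
        unfolding p_def poly_sum
        by (intro sum.cong refl) (simp only: poly_monom homog[OF f(2)[rule_format] x] mult.commute)
      also have "\<dots> = w (x * cochar d s)" using f sum_apply by simp
      also have "\<dots> = v (x * cochar d s * u) - v (x * cochar d s)" using xc by (simp add: w_def)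
      also have "x * cochar d s * u = (x * M s) * cochar d s"
        using x uC MC by (simp add: comm assoc_mult_mat[of _ n d _ d _ d])
      also have "v \<dots> = s ^ k * poly q s" using homog[OF v, of "x * M s"] x MC q by simp
      also have "v (x * cochar d s) = s ^ k * v x" using homog[OF v x] .
      finally show ?thesis by (simp add: poly_monom algebra_simps)
    qed
    hence "p - monom 1 k * (q - [:v x:]) = 0" by (rule poly_eq_0_if_infinite_roots)
    hence "coeff p l = coeff (monom 1 k * (q - [:v x:])) l" by simp
    \<comment> \<open>Below \<open>k\<close> the factor \<open>monom 1 k\<close> suffices; at
      \<open>k\<close> itself the constant term of \<open>q\<close> cancels against
      \<open>v x\<close>.\<close>
    also have "\<dots> = 0" using l q0 by (cases "l = k") (auto simp: coeff_monom_mult)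
    also have "coeff p l = f l x"
      using l f(1) by (simp add: p_def coeff_sum)
    finally show ?thesis .
  qed
  moreover have "f l x = 0" if "x \<notin> carrier_mat n d" for l x
    using f(2) homog_mat_poly mat_poly_outside that by metis
  ultimately have "f l = 0" if "l \<in> I" "l \<le> k" for l
    using that by (auto simp: fun_eq_iff)
  hence "f l \<in> graded n d {k<..}" if "l \<in> I" for l
    using that f(2) by (cases "l \<le> k") (auto intro: homog_graded fun_space.subspace_0[OF subspace_graded])
  thus ?thesis unfolding w_def[symmetric] f(3) by (intro fun_space.subspace_sum[OF subspace_graded])
qed

text \<open>The same comparison with \<open>inverse s\<close> in the cocharacter, since only then
  does the conjugate of a lower unitriangular matrix have polynomial entries. Negative powers of
  \<open>s\<close> are cleared by the factor \<open>s ^ (N + k)\<close>.\<close>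

lemma ract_lower_unitriangular:
  fixes v :: "'a::alg_closed_field mat \<Rightarrow> 'a"
  assumes v: "v \<in> homog n d k" and u: "u \<in> lower_unitriangular d"
  shows "ract n d u v \<in> graded n d {..k}"
proof -
  define w where "w = ract n d u v"
  note vR = homog_mat_poly[OF v]
  have uC: "u \<in> carrier_mat d d" using u by (simp add: lower_unitriangular_def)
  have "w \<in> mat_poly_funs n d" unfolding w_def by (intro ract_mat_poly vR uC)
  then obtain I f where f: "finite I" "\<forall>l. f l \<in> homog n d l" "w = sum f I"
    using graded_sum[OF mat_poly_graded] by blast
  \<comment> \<open>A bound for all degrees in \<open>I\<close>, so that the natural subtraction
    \<open>N + k - l\<close> is exact; the inserted \<open>0\<close> covers empty
    \<open>I\<close>.\<close>
  define N where "N = Max (insert 0 I)"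
  have N: "l \<le> N" if "l \<in> I" for l using that f(1) by (simp add: N_def)
  define M where "M s = mat d d (\<lambda>(i, j). if j \<le> i then u $$ (i, j) * s ^ (i - j) else 0)" for s
  have MC: "M s \<in> carrier_mat d d" for s by (simp add: M_def)
  have comm: "cochar d (inverse s) * u = M s * cochar d (inverse s)" if s: "s \<noteq> 0" for s
  proof (rule eq_matI)
    fix i j assume "i < dim_row (M s * cochar d (inverse s))" "j < dim_col (M s * cochar d (inverse s))"
    hence ij: "i < d" "j < d" using MC[of s] by auto
    show "(cochar d (inverse s) * u) $$ (i, j) = (M s * cochar d (inverse s)) $$ (i, j)"
    proof (cases "j \<le> i")
      case True
      have "inverse s ^ (d - i) = (s * inverse s) ^ (i - j) * inverse s ^ (d - i)" using s by simp
      also have "\<dots> = s ^ (i - j) * inverse s ^ ((i - j) + (d - i))"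
        by (simp only: power_mult_distrib power_add mult.assoc)
      also have "(i - j) + (d - i) = d - j" using True ij by simp
      finally have "inverse s ^ (d - i) = s ^ (i - j) * inverse s ^ (d - j)" .
      thus ?thesis using ij True
        by (simp add: cochar_def mat_diag_mult_left[OF uC] mat_diag_mult_right[OF MC]) (simp add: M_def)
    next
      case False
      thus ?thesis using ij u
        by (simp add: cochar_def mat_diag_mult_left[OF uC] mat_diag_mult_right[OF MC])
           (simp add: M_def lower_unitriangular_def)
    qed
  qed (use uC MC[of s] in auto)
  have "f l x = 0" if l: "l \<in> I" "k < l" and x: "x \<in> carrier_mat n d" for l x
  proof -
    have "\<exists>q. \<forall>s. v (x * M s) = poly q s"
    proof (rule mat_poly_along_curve[OF vR])
      show "x * M s \<in> carrier_mat n d" for s using x MC by simp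
      fix i j assume ij: "i < n" "j < d"
      have "(x * M s) $$ (i, j) = poly (\<Sum>m<d. monom (x $$ (i, m) * (if j \<le> m then u $$ (m, j) else 0)) (m - j)) s" for s
      proof -
        have "(x * M s) $$ (i, j) = (\<Sum>m<d. x $$ (i, m) * M s $$ (m, j))"
          using x MC[of s] ij by (auto simp: scalar_prod_def atLeast0LessThan)
        also have "\<dots> = (\<Sum>m<d. poly (monom (x $$ (i, m) * (if j \<le> m then u $$ (m, j) else 0)) (m - j)) s)"
          using ij by (intro sum.cong) (auto simp: M_def poly_monom)
        finally show ?thesis by (simp add: poly_sum)
      qed
      thus "\<exists>p. \<forall>s. (x * M s) $$ (i, j) = poly p s" by blast
    qed
    then obtain q where q: "\<And>s. v (x * M s) = poly q s" by blast
    \<comment> \<open>Clearing denominators reverses the order of degrees: the component of degree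
      \<open>l\<close> becomes the coefficient at \<open>N + k - l\<close>.\<close>
    define p where "p = (\<Sum>l\<in>I. monom (f l x) (N + k - l))"
    have sum_apply: "sum f J y = (\<Sum>l\<in>J. f l y)" if "finite J" for J y
      using that by (induction J) auto
    have "poly (p - monom 1 N * q) s = 0" if s: "s \<noteq> 0" for s
    proof -
      define r where "r = inverse s"
      have r: "r \<noteq> 0" using s by (simp add: r_def)
      have xc: "x * cochar d r \<in> carrier_mat n d" using x by simp
      have homog: "F (y * cochar d r) = r ^ j * F y" if "F \<in> homog n d j" "y \<in> carrier_mat n d" for F y j
      proof -
        have "ract n d (cochar d r) F y = fscale (r ^ j) F y" using that r by (simp add: homog_def)
        thus ?thesis using that by (simp add: fscale_apply)
      qed
      have pow: "s ^ (N + k - l) = s ^ (N + k) * r ^ l" if "l \<in> I" for l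
      proof -
        have "s ^ (N + k) * r ^ l = s ^ (N + k - l) * (s ^ l * r ^ l)"
          using N[OF that] by (simp flip: power_add mult.assoc)
        also have "s ^ l * r ^ l = 1" using s by (simp add: r_def flip: power_mult_distrib)
        finally show ?thesis by simp
      qed
      have "poly p s = (\<Sum>l\<in>I. s ^ (N + k) * f l (x * cochar d r))"
        unfolding p_def poly_sum
        by (intro sum.cong refl)
           (simp only: poly_monom homog[OF f(2)[rule_format] x] pow mult.assoc mult.commute mult.left_commute)
      also have "\<dots> = s ^ (N + k) * w (x * cochar d r)"
        using f sum_apply by (simp add: sum_distrib_left)
      also have "w (x * cochar d r) = v (x * cochar d r * u)" using xc by (simp add: w_def)
      also have "x * cochar d r * u = (x * M s) * cochar d r"
        using x uC MC by (simp add: comm[OF s, folded r_def] assoc_mult_mat[of _ n d _ d _ d])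
      also have "v \<dots> = r ^ k * poly q s" using homog[OF v, of "x * M s"] x MC q by simp
      also have "s ^ (N + k) * (r ^ k * poly q s) = s ^ N * ((s ^ k * r ^ k) * poly q s)"
        by (simp only: power_add mult.assoc)
      also have "s ^ k * r ^ k = 1" using s by (simp add: r_def flip: power_mult_distrib)
      finally show ?thesis by (simp add: poly_monom)
    qed
    hence "p - monom 1 N * q = 0" by (rule poly_eq_0_if_infinite_roots)
    hence "coeff p (N + k - l) = coeff (monom 1 N * q) (N + k - l)" by simp
    \<comment> \<open>For \<open>l > k\<close> the exponent \<open>N + k - l\<close> lies below
      \<open>N\<close>, while the polynomial is a multiple of \<open>monom 1 N\<close>.\<close>
    also have "\<dots> = 0" using l N[OF l(1)] by (simp add: coeff_monom_mult)
    also have "coeff p (N + k - l) = (\<Sum>l'\<in>I. if l' = l then f l x else 0)"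
      unfolding p_def coeff_sum using N l by (intro sum.cong refl) (fastforce dest: N)
    also have "\<dots> = f l x" using l f(1) by simp
    finally show ?thesis .
  qed
  moreover have "f l x = 0" if "x \<notin> carrier_mat n d" for l x
    using f(2) homog_mat_poly mat_poly_outside that by metis
  ultimately have "f l = 0" if "l \<in> I" "k < l" for l
    using that by (auto simp: fun_eq_iff)
  hence "f l \<in> graded n d {..k}" if "l \<in> I" for l
    using that f(2) by (cases "k < l") (auto intro: homog_graded fun_space.subspace_0[OF subspace_graded])
  thus ?thesis unfolding w_def[symmetric] f(3) by (intro fun_space.subspace_sum[OF subspace_graded])
qed

section \<open>Torus and weights\<close>

lemma lower_unitriangular_mult:
  assumes "l \<in> lower_unitriangular m" "l' \<in> lower_unitriangular m"
  shows "l * l' \<in> lower_unitriangular m"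
proof -
  have entry: "(l * l') $$ (i, j) = (\<Sum>k<m. l $$ (i, k) * l' $$ (k, j))" if "i < m" "j < m" for i j
    using assms that by (auto simp: lower_unitriangular_def scalar_prod_def atLeast0LessThan)
  have "(l * l') $$ (i, i) = 1" if i: "i < m" for i
  proof -
    have "(\<Sum>k<m. l $$ (i, k) * l' $$ (k, i)) = (\<Sum>k<m. if k = i then 1 else 0)"
    proof (rule sum.cong)
      fix k assume "k \<in> {..<m}"
      thus "l $$ (i, k) * l' $$ (k, i) = (if k = i then 1 else 0)"
        using assms i by (cases i k rule: linorder_cases) (auto simp: lower_unitriangular_def)
    qed simp
    thus ?thesis using entry i by simp
  qed
  moreover have "(l * l') $$ (i, j) = 0" if ij: "i < m" "j < m" "i < j" for i j
  proof -
    have "l $$ (i, k) * l' $$ (k, j) = 0" if "k < m" for k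
      using assms ij that by (cases "i < k") (auto simp: lower_unitriangular_def)
    thus ?thesis unfolding entry[OF ij(1,2)] by (intro sum.neutral ballI) simp
  qed
  ultimately show ?thesis using assms by (auto simp: lower_unitriangular_def)
qed

lemma torus_diag:
  assumes "t \<in> torus m"
  obtains a where "t = mat_diag m a" "\<And>i. i < m \<Longrightarrow> a i \<noteq> 0"
proof -
  define a where "a i = t $$ (i, i)" for i
  have tC: "t \<in> carrier_mat m m" using assms by (simp add: torus_GL)
  have dims: "dim_row t = m" "dim_col t = m" using tC by auto
  have t: "t = mat_diag m a"
    using assms dims by (auto simp: a_def mat_diag_def torus_def diagonal_mat_def intro!: eq_matI)
  have "det t = prod_list (diag_mat t)"
    unfolding t by (intro det_upper_triangular[of _ m]) (auto simp: mat_diag_def)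
  hence "prod_list (diag_mat t) \<noteq> 0" using assms torus_GL carrier_GL by fastforce
  hence "a i \<noteq> 0" if "i < m" for i using that dims by (simp add: prod_list_diag_prod a_def)
  thus thesis using that t by blast
qed

lemma torus_mat_diag:
  assumes "\<And>i. i < m \<Longrightarrow> a i \<noteq> 0"
  shows "mat_diag m a \<in> torus m"
proof -
  have "det (mat_diag m a) = prod_list (diag_mat (mat_diag m a))"
    by (intro det_upper_triangular[of _ m]) (auto simp: mat_diag_def)
  also have "\<dots> \<noteq> 0" using assms by (simp add: prod_list_diag_prod mat_diag_def)
  finally have "mat_diag m a \<in> carrier (GL m)" unfolding carrier_GL by simp
  thus ?thesis unfolding torus_def diagonal_mat_def by (simp add: mat_diag_def)
qed

lemma weight_mat_diag: "weight m w (mat_diag m a) = (\<Prod>i<m. a i powi w i)"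
  unfolding weight_def by (intro prod.cong) (auto simp: mat_diag_def)

lemma weight_nonzero: "t \<in> torus m \<Longrightarrow> weight m w t \<noteq> 0"
  by (erule torus_diag) (auto simp: weight_mat_diag)

lemma torus_mult:
  assumes "s \<in> torus m" "t \<in> torus m"
  shows "s * t \<in> torus m" "weight m w (s * t) = weight m w s * weight m w t"
proof -
  obtain a where a: "s = mat_diag m a" "\<And>i. i < m \<Longrightarrow> a i \<noteq> 0" using torus_diag[OF assms(1)] by blast
  obtain b where b: "t = mat_diag m b" "\<And>i. i < m \<Longrightarrow> b i \<noteq> 0" using torus_diag[OF assms(2)] by blast
  have st: "s * t = mat_diag m (\<lambda>i. a i * b i)" by (simp add: a b)
  show "s * t \<in> torus m" unfolding st by (intro torus_mat_diag) (simp add: a b)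
  show "weight m w (s * t) = weight m w s * weight m w t"
    unfolding st unfolding a(1) b(1) weight_mat_diag by (simp add: power_int_mult_distrib prod.distrib)
qed

lemma torus_conj_lower:
  assumes "t \<in> torus m" and l: "l \<in> lower_unitriangular m"
  shows "\<exists>l'\<in>lower_unitriangular m. t * l = l' * t"
proof -
  obtain a where a: "t = mat_diag m a" "\<And>i. i < m \<Longrightarrow> a i \<noteq> 0" using torus_diag[OF assms(1)] by blast
  define l' where "l' = mat m m (\<lambda>(i, j). a i * l $$ (i, j) / a j)"
  have lC: "l \<in> carrier_mat m m" and l'C: "l' \<in> carrier_mat m m"
    using l by (auto simp: lower_unitriangular_def l'_def)
  have "l' \<in> lower_unitriangular m" using l a(2) by (auto simp: lower_unitriangular_def l'_def)
  moreover have "t * l = l' * t"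
    unfolding a(1) mat_diag_mult_left[OF lC] mat_diag_mult_right[OF l'C]
    by (rule cong_mat) (auto simp: l'_def a(2))
  ultimately show ?thesis by blast
qed

lemma torus_conj_upper:
  assumes "t \<in> torus m" and u: "u \<in> upper_unitriangular m"
  shows "\<exists>u'\<in>upper_unitriangular m. u * t = t * u'"
proof -
  obtain a where a: "t = mat_diag m a" "\<And>i. i < m \<Longrightarrow> a i \<noteq> 0" using torus_diag[OF assms(1)] by blast
  define u' where "u' = mat m m (\<lambda>(i, j). u $$ (i, j) * a j / a i)"
  have uC: "u \<in> carrier_mat m m" and u'C: "u' \<in> carrier_mat m m"
    using u by (auto simp: upper_unitriangular_def u'_def)
  have "u' \<in> upper_unitriangular m" using u a(2) by (auto simp: upper_unitriangular_def u'_def)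
  moreover have "u * t = t * u'"
    unfolding a(1) mat_diag_mult_left[OF u'C] mat_diag_mult_right[OF uC]
    by (rule cong_mat) (auto simp: u'_def a(2))
  ultimately show ?thesis by blast
qed

text \<open>The pairing of the weight \<open>w\<close> with the cocharacter, that is, the degree of
  a vector of weight \<open>w\<close>. It may be negative.\<close>

definition height :: "nat \<Rightarrow> (nat \<Rightarrow> int) \<Rightarrow> int" where
  "height d w = (\<Sum>i<d. int (d - i) * w i)"

lemma weight_cochar:
  assumes "s \<noteq> 0"
  shows "weight d w (cochar d s) = s powi height d w"
proof -
  have "s powi (\<Sum>i\<in>I. f i) = (\<Prod>i\<in>I. s powi f i)" if "finite I" for I :: "nat set" and f
    using that assms by (induction I) (simp_all add: power_int_add)
  thus ?thesis unfolding height_def cochar_def weight_mat_diag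
    by (simp add: power_int_mult del: of_nat_diff)
qed

lemma exists_separating_scalar_int:
  assumes "int l \<noteq> h"
  shows "\<exists>s::'a::alg_closed_field. s \<noteq> 0 \<and> s ^ l \<noteq> s powi h"
proof (cases "h \<ge> 0")
  case True
  then obtain m where "h = int m" using nonneg_int_cases by blast
  thus ?thesis using exists_separating_scalar[of l m, where 'a = 'a] assms by auto
next
  case False
  \<comment> \<open>A negative exponent is moved to the other side: the comparison becomes one of
    \<open>s ^ (l + m)\<close> with \<open>1\<close>.\<close>
  define m where "m = nat (- h)"
  have h: "h = - int m" "m > 0" using False by (auto simp: m_def)
  obtain s :: 'a where s: "s \<noteq> 0" "s ^ (l + m) \<noteq> s ^ 0"
    using exists_separating_scalar[of "l + m" 0, where 'a = 'a] h by auto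
  have "s ^ l \<noteq> s powi h"
  proof
    assume "s ^ l = s powi h"
    hence "s ^ l * s ^ m = inverse (s ^ m) * s ^ m" by (simp add: h power_int_minus)
    thus False using s by (simp add: power_add)
  qed
  thus ?thesis using s by blast
qed

lemma stable_cochar_stable: "stable_subspace d (ract n d) V \<Longrightarrow> cochar_stable n d V"
  unfolding stable_subspace_def cochar_stable_def using cochar_GL by blast

section \<open>One step of a good filtration\<close>

text \<open>Frobenius reciprocity: the isomorphism onto \<open>Y(\<omega>)\<close> amounts to a \<open>B\<^sup>-\<close>-equivariant functional on \<open>V\<close>,
  the value at the identity.\<close>

lemma frobenius_functional:
  assumes V: "stable_subspace d (ract n d) V" and W: "stable_subspace d (ract n d) W"
    and iso: "quotient_isomorphic d (ract n d) V W (left_transl d (carrier (GL d))) (Y_module d a)"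
  obtains \<epsilon> where
    "\<And>v w. v \<in> V \<Longrightarrow> w \<in> V \<Longrightarrow> \<epsilon> (v + w) = \<epsilon> v + \<epsilon> w"
    "\<And>c v. v \<in> V \<Longrightarrow> \<epsilon> (fscale c v) = c * \<epsilon> v"
    "\<And>v. v \<in> V \<Longrightarrow> \<forall>g\<in>carrier (GL d). \<epsilon> (ract n d g v) = 0 \<Longrightarrow> v \<in> W"
    "\<And>t v. t \<in> torus d \<Longrightarrow> v \<in> V \<Longrightarrow> \<epsilon> (ract n d t v) = weight d a t * \<epsilon> v"
    "\<And>l v. l \<in> lower_unitriangular d \<Longrightarrow> v \<in> V \<Longrightarrow> \<epsilon> (ract n d l v) = \<epsilon> v"
    "\<And>f. f \<in> Y_module d a \<Longrightarrow> \<exists>w\<in>V. \<forall>g\<in>carrier (GL d). \<epsilon> (ract n d (inv\<^bsub>GL d\<^esub> g) w) = f g"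
proof -
  obtain \<phi> where bij: "bij_betw \<phi> (coset W ` V) (Y_module d a)"
    and add: "\<And>v w. v \<in> V \<Longrightarrow> w \<in> V \<Longrightarrow> \<phi> (coset W (v + w)) = \<phi> (coset W v) + \<phi> (coset W w)"
    and scale: "\<And>c v. v \<in> V \<Longrightarrow> \<phi> (coset W (fscale c v)) = fscale c (\<phi> (coset W v))"
    and equiv: "\<And>g v. g \<in> carrier (GL d) \<Longrightarrow> v \<in> V \<Longrightarrow>
      \<phi> (coset W (ract n d g v)) = left_transl d (carrier (GL d)) g (\<phi> (coset W v))"
    using iso unfolding quotient_isomorphic_def by blast
  define \<epsilon> where "\<epsilon> v = \<phi> (coset W v) (1\<^sub>m d)" for v
  have sV: "fun_space.subspace V" and sW: "fun_space.subspace W"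
    using V W by (auto simp: stable_subspace_def)
  have \<phi>Y: "\<phi> (coset W v) \<in> Y_module d a" if "v \<in> V" for v
    using bij that by (auto simp: bij_betw_def)
  \<comment> \<open>By equivariance, \<open>\<epsilon>\<close> along the orbit of \<open>v\<close>
    recovers every value of the function attached to \<open>v\<close>.\<close>
  have eps: "\<epsilon> (ract n d g v) = \<phi> (coset W v) (inv\<^bsub>GL d\<^esub> g)" if "g \<in> carrier (GL d)" "v \<in> V" for g v
  proof -
    have "inv\<^bsub>GL d\<^esub> g * 1\<^sub>m d = inv\<^bsub>GL d\<^esub> g"
      using GL_carrierD[OF GL_inv(1)[OF that(1)]] by (rule right_mult_one_mat)
    thus ?thesis unfolding \<epsilon>_def equiv[OF that] left_transl_def by simp
  qed
  show thesis
  proof (rule that)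
    show "\<epsilon> (v + w) = \<epsilon> v + \<epsilon> w" if "v \<in> V" "w \<in> V" for v w
      unfolding \<epsilon>_def add[OF that] plus_fun_apply ..
    show "\<epsilon> (fscale c v) = c * \<epsilon> v" if "v \<in> V" for c v
      unfolding \<epsilon>_def scale[OF that] fscale_apply ..
  next
    fix v assume v: "v \<in> V" and zero: "\<forall>g\<in>carrier (GL d). \<epsilon> (ract n d g v) = 0"
    have V0: "0 \<in> V" using sV by (rule fun_space.subspace_0)
    have "\<phi> (coset W v) g = 0" for g
    proof (cases "g \<in> carrier (GL d)")
      case True
      thus ?thesis using bspec[OF zero GL_inv(1)[OF True]] eps[OF GL_inv(1)[OF True] v] by simp
    next
      case False
      \<comment> \<open>Regular functions on the group are \<open>0\<close> off it by
        convention.\<close>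
      have "\<phi> (coset W v) \<in> GL_regular_funs d"
        using \<phi>Y[OF v] by (simp add: Y_module_def funs_mod_lower_unitriangular_def)
      thus ?thesis using False by (auto simp: GL_regular_funs_def)
    qed
    hence "\<phi> (coset W v) = 0" by (intro ext) simp
    moreover have "\<phi> (coset W 0) = 0"
      using add[OF V0 V0] unfolding add_0_left add_cancel_right_right .
    ultimately have "coset W v = coset W 0"
      using inj_onD[OF bij_betw_imp_inj_on[OF bij], of "coset W v" "coset W 0"] v V0
      by (simp only: imageI)
    moreover have "v + 0 \<in> coset W v"
      unfolding coset_def by (rule imageI) (rule fun_space.subspace_0[OF sW])
    ultimately obtain w where "w \<in> W" "v + 0 = 0 + w" unfolding coset_def by blast
    thus "v \<in> W" by (simp only: add_0_left add_0_right)
  next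
    fix t :: "'a mat" and v assume t: "t \<in> torus d" and v: "v \<in> V"
    note tG = torus_GL[OF t]
    have "right_transl (carrier (GL d)) t (\<phi> (coset W v)) = fscale (inverse (weight d a t)) (\<phi> (coset W v))"
      using \<phi>Y[OF v] t unfolding Y_module_def by blast
    \<comment> \<open>At the inverse of \<open>t\<close> the right translate takes its value at the
      identity, which is \<open>\<epsilon> v\<close>; the inverse of the weight thereby changes
      sides.\<close>
    from fun_cong[OF this, of "inv\<^bsub>GL d\<^esub> t"]
    have "\<epsilon> v = inverse (weight d a t) * \<phi> (coset W v) (inv\<^bsub>GL d\<^esub> t)"
      using tG by (simp add: right_transl_def fscale_apply \<epsilon>_def)
    thus "\<epsilon> (ract n d t v) = weight d a t * \<epsilon> v"
      unfolding eps[OF tG v] using weight_nonzero[OF t, of a] by simp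
  next
    fix l :: "'a mat" and v assume l: "l \<in> lower_unitriangular d" and v: "v \<in> V"
    note lG = lower_unitriangular_GL[OF l]
    have "right_transl (carrier (GL d)) l (\<phi> (coset W v)) = \<phi> (coset W v)"
      using \<phi>Y[OF v] l unfolding Y_module_def funs_mod_lower_unitriangular_def by blast
    from fun_cong[OF this, of "inv\<^bsub>GL d\<^esub> l"] show "\<epsilon> (ract n d l v) = \<epsilon> v"
      unfolding eps[OF lG v] using lG by (simp add: right_transl_def \<epsilon>_def)
  next
    fix f :: "'a mat \<Rightarrow> 'a" assume "f \<in> Y_module d a"
    then obtain w where w: "w \<in> V" "f = \<phi> (coset W w)"
      using bij unfolding bij_betw_def by blast
    have "\<epsilon> (ract n d (inv\<^bsub>GL d\<^esub> g) w) = f g" if "g \<in> carrier (GL d)" for g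
      using eps[OF GL_inv(1)[OF that] w(1)] that by (simp add: w(2))
    thus "\<exists>w\<in>V. \<forall>g\<in>carrier (GL d). \<epsilon> (ract n d (inv\<^bsub>GL d\<^esub> g) w) = f g"
      by (intro bexI[OF _ w(1)] ballI)
  qed
qed

lemma subspace_zero_functional:
  assumes "fun_space.subspace V"
    and "\<And>v w. v \<in> V \<Longrightarrow> w \<in> V \<Longrightarrow> \<epsilon> (v + w) = \<epsilon> v + \<epsilon> w"
    and "\<And>c v. v \<in> V \<Longrightarrow> \<epsilon> (fscale c v) = c * (\<epsilon> v :: 'a::field)"
  shows "fun_space.subspace {v \<in> V. \<epsilon> v = 0}"
proof (rule fun_space.subspaceI)
  have "0 \<in> V" using assms(1) by (rule fun_space.subspace_0)
  moreover have "\<epsilon> 0 = 0" using assms(2)[OF \<open>0 \<in> V\<close> \<open>0 \<in> V\<close>]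
    unfolding add_0_left add_cancel_right_right .
  ultimately show "0 \<in> {v \<in> V. \<epsilon> v = 0}" by blast
  show "v + w \<in> {v \<in> V. \<epsilon> v = 0}" if "v \<in> {v \<in> V. \<epsilon> v = 0}" "w \<in> {v \<in> V. \<epsilon> v = 0}" for v w
    using that assms(2)[of v w] fun_space.subspace_add[OF assms(1), of v w] by simp
  show "fscale c v \<in> {v \<in> V. \<epsilon> v = 0}" if "v \<in> {v \<in> V. \<epsilon> v = 0}" for c v
    using that assms(3)[of v c] fun_space.subspace_scale[OF assms(1), of v c] by simp
qed

text \<open>The matrix coefficient is a polynomial function, so its vanishing on the dense big cell
  is enough.\<close>

lemma functional_vanishes_on_orbit:
  fixes v :: "'a::alg_closed_field mat \<Rightarrow> 'a"
  assumes "functional \<epsilon>" "v \<in> mat_poly_funs n d"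
    and "\<And>l t u. l \<in> lower_unitriangular d \<Longrightarrow> t \<in> torus d \<Longrightarrow> u \<in> upper_unitriangular d \<Longrightarrow>
      \<epsilon> (ract n d (l * t * u) v) = 0"
    and "g \<in> carrier_mat d d"
  shows "\<epsilon> (ract n d g v) = 0"
proof -
  obtain p where p: "p \<in> mat_poly_funs d d" "\<And>g. g \<in> carrier_mat d d \<Longrightarrow> \<epsilon> (ract n d g v) = p g"
    using matrix_coefficient_poly[OF assms(2,1)] by blast
  have "p = 0"
  proof (rule big_cell_dense[OF p(1)])
    fix l t u :: "'a mat"
    assume ltu: "l \<in> lower_unitriangular d" "t \<in> torus d" "u \<in> upper_unitriangular d"
    hence "l * t * u \<in> carrier_mat d d"
      using lower_unitriangular_GL torus_GL upper_unitriangular_GL by (metis GL_carrierD GL_mult)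
    thus "p (l * t * u) = 0" using p(2) assms(3)[OF ltu] by metis
  qed
  thus ?thesis using p(2)[OF assms(4)] by simp
qed

text \<open>A transformation rule under left multiplication is a closed condition, hence may be
  verified on the big cell, where \<open>p\<close> will be known explicitly.\<close>

lemma big_cell_mult:
  fixes p :: "'a::alg_closed_field mat \<Rightarrow> 'a"
  assumes p: "p \<in> mat_poly_funs d d" and g: "g \<in> carrier_mat d d"
    and cell: "\<And>l t u. l \<in> lower_unitriangular d \<Longrightarrow> t \<in> torus d \<Longrightarrow> u \<in> upper_unitriangular d \<Longrightarrow>
      p (g * (l * t * u)) = c * p (l * t * u)"
    and x: "x \<in> carrier_mat d d"
  shows "p (g * x) = c * p x"
proof -
  let ?q = "fun_on (carrier_mat d d) (\<lambda>x. p (g * x)) - fscale c p"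
  have "?q \<in> mat_poly_funs d d"
    by (intro mat_poly_diff mat_poly_scale p mat_poly_compose[OF p] mat_poly_map_mult[where b = d]
          mat_poly_map_const mat_poly_map_id g)
  moreover have "?q (l * t * u) = 0"
    if ltu: "l \<in> lower_unitriangular d" "t \<in> torus d" "u \<in> upper_unitriangular d" for l t u
  proof -
    have "l * t * u \<in> carrier_mat d d"
      by (intro GL_carrierD GL_mult lower_unitriangular_GL torus_GL upper_unitriangular_GL ltu)
    thus ?thesis using cell[OF ltu] by (simp add: fscale_apply)
  qed
  ultimately have "?q = 0" by (rule big_cell_dense)
  from fun_cong[OF this, of x] show ?thesis using x by (simp add: fscale_apply)
qed

text \<open>Homogeneity of \<open>w\<close> keeps \<open>b - w\<close> in degree \<open>k\<close>,
  so that the step can be repeated down the filtration.\<close>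

lemma filtration_step:
  fixes V W :: "('a::alg_closed_field mat \<Rightarrow> 'a) set"
  assumes V: "stable_subspace d (ract n d) V" and W: "stable_subspace d (ract n d) W"
    and VR: "V \<subseteq> mat_poly_funs n d"
    and iso: "quotient_isomorphic d (ract n d) V W (left_transl d (carrier (GL d))) (Y_module d a)"
    and b: "b \<in> homog n d k"
    and ub: "\<And>u. u \<in> upper_unitriangular d \<Longrightarrow> ract n d u b - b \<in> V"
  shows "\<exists>w\<in>V \<inter> homog n d k. \<forall>u\<in>upper_unitriangular d. ract n d u (b - w) - (b - w) \<in> W"
proof -
  obtain \<epsilon> where add: "\<And>v w. v \<in> V \<Longrightarrow> w \<in> V \<Longrightarrow> \<epsilon> (v + w) = \<epsilon> v + \<epsilon> w"
    and scale: "\<And>c v. v \<in> V \<Longrightarrow> \<epsilon> (fscale c v) = c * \<epsilon> v"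
    and in_W: "\<And>v. v \<in> V \<Longrightarrow> \<forall>g\<in>carrier (GL d). \<epsilon> (ract n d g v) = 0 \<Longrightarrow> v \<in> W"
    and torus: "\<And>t v. t \<in> torus d \<Longrightarrow> v \<in> V \<Longrightarrow> \<epsilon> (ract n d t v) = weight d a t * \<epsilon> v"
    and lower: "\<And>l v. l \<in> lower_unitriangular d \<Longrightarrow> v \<in> V \<Longrightarrow> \<epsilon> (ract n d l v) = \<epsilon> v"
    and surj: "\<And>f. f \<in> Y_module d a \<Longrightarrow> \<exists>w\<in>V. \<forall>g\<in>carrier (GL d). \<epsilon> (ract n d (inv\<^bsub>GL d\<^esub> g) w) = f g"
    by (rule frobenius_functional[OF V W iso]) (rule that)
  have sV: "fun_space.subspace V" and sW: "fun_space.subspace W"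
    and actV: "\<And>g v. g \<in> carrier (GL d) \<Longrightarrow> v \<in> V \<Longrightarrow> ract n d g v \<in> V"
    and actW: "\<And>g v. g \<in> carrier (GL d) \<Longrightarrow> v \<in> W \<Longrightarrow> ract n d g v \<in> W"
    using V W by (auto simp only: stable_subspace_def)
  note lG = lower_unitriangular_GL and tG = torus_GL and uG = upper_unitriangular_GL
  have bR: "b \<in> mat_poly_funs n d" using b by (rule homog_mat_poly)
  define Z where "Z = {v \<in> V. \<epsilon> v = 0}"
  have sZ: "fun_space.subspace Z"
    unfolding Z_def by (rule subspace_zero_functional[OF sV add scale])
  \<comment> \<open>The cocharacter multiplies \<open>\<epsilon> v\<close> by \<open>s ^ l\<close>
    and also by \<open>s\<close> to the power \<open>height d a\<close>; so
    \<open>\<epsilon>\<close> detects only the degree \<open>height d a\<close>.\<close>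
  have eps_homog: "\<epsilon> v = 0" if v: "v \<in> V" "v \<in> homog n d l" and l: "int l \<noteq> height d a" for v l
  proof -
    obtain s :: 'a where s: "s \<noteq> 0" "s ^ l \<noteq> s powi height d a"
      using exists_separating_scalar_int[OF l] by metis
    have "ract n d (cochar d s) v = fscale (s ^ l) v" using v(2) s(1) unfolding homog_def by blast
    hence "s ^ l * \<epsilon> v = s powi height d a * \<epsilon> v"
      using torus[OF cochar_torus[OF s(1)] v(1)] scale[OF v(1)] weight_cochar[OF s(1)] by metis
    thus ?thesis using s(2) by simp
  qed
  have graded_Z: "v \<in> Z" if "v \<in> graded n d L" "v \<in> V" "\<And>l. l \<in> L \<Longrightarrow> int l \<noteq> height d a" for v L
    using stable_cochar_stable[OF V] sZ _ that(1,2)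
  proof (rule graded_stable_subset)
    show "homog n d l \<inter> V \<subseteq> Z" if "l \<in> L" for l
      using eps_homog \<open>\<And>l. l \<in> L \<Longrightarrow> int l \<noteq> height d a\<close>[OF that] unfolding Z_def by blast
  qed
  \<comment> \<open>Here \<open>u\<close> acts first and \<open>l\<close> last, so the equivariance
    of \<open>\<epsilon>\<close> can strip off \<open>l\<close> and then \<open>t\<close>.\<close>
  have cell: "ract n d (l * t * u) v = ract n d l (ract n d t (ract n d u v))"
    if "l \<in> lower_unitriangular d" "t \<in> torus d" "u \<in> upper_unitriangular d" for l t u v
    using lG[OF that(1)] tG[OF that(2)] uG[OF that(3)]
    by (simp add: ract_ract assoc_mult_mat[of _ d d _ d _ d])
  show ?thesis
  proof (cases "height d a \<le> int k")
    case True
    \<comment> \<open>For \<open>v\<close> of degree \<open>l > k\<close>, both \<open>v\<close> and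
      its change under \<open>u\<close> live in degrees above \<open>height d a\<close>, where
      \<open>\<epsilon>\<close> vanishes. So \<open>\<epsilon>\<close> vanishes on the big cell
      translates of \<open>v\<close>, hence on its orbit.\<close>
    have "homog n d l \<inter> V \<subseteq> W" if l: "k < l" for l
    proof
      fix v assume "v \<in> homog n d l \<inter> V"
      hence v: "v \<in> homog n d l" "v \<in> V" by auto
      obtain \<epsilon>' where \<epsilon>': "functional \<epsilon>'" "\<And>v. v \<in> V \<Longrightarrow> \<epsilon>' v = \<epsilon> v"
      proof -
        have "\<epsilon> v = 0" if "v \<in> V" "v \<in> {0}" for v
          using fun_space.subspace_0[OF sZ] that(2) unfolding Z_def by simp
        hence "\<exists>\<epsilon>'. functional \<epsilon>' \<and> (\<forall>v\<in>V. \<epsilon>' v = \<epsilon> v) \<and> (\<forall>w\<in>{0}. \<epsilon>' w = 0)"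
          using functional_extension[OF sV fun_space.subspace_single_0 add scale] by blast
        thus ?thesis using that by blast
      qed
      have zero: "\<epsilon>' (ract n d (r * t * u) v) = 0"
        if rtu: "r \<in> lower_unitriangular d" "t \<in> torus d" "u \<in> upper_unitriangular d" for r t u
      proof -
        have uvV: "ract n d u v \<in> V" by (intro actV uG rtu v)
        have "ract n d u v - v \<in> graded n d {l<..}"
          by (rule ract_upper_unitriangular[OF v(1) rtu(3)])
        moreover have "ract n d u v - v \<in> V" by (intro fun_space.subspace_diff[OF sV] uvV v)
        ultimately have "ract n d u v - v \<in> Z" by (rule graded_Z) (use True l in auto)
        moreover have "v \<in> Z" using v eps_homog[OF v(2,1)] True l unfolding Z_def by simp
        ultimately have "ract n d u v - v + v \<in> Z" by (rule fun_space.subspace_add[OF sZ])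
        hence "\<epsilon> (ract n d u v) = 0" unfolding Z_def diff_add_cancel by blast
        hence "\<epsilon> (ract n d r (ract n d t (ract n d u v))) = 0"
          using lower[OF rtu(1) actV[OF tG[OF rtu(2)] uvV]] torus[OF rtu(2) uvV] by simp
        moreover have "ract n d r (ract n d t (ract n d u v)) \<in> V"
          by (intro actV lG tG uG rtu v)
        ultimately show ?thesis using \<epsilon>'(2) cell[OF rtu] by simp
      qed
      show "v \<in> W"
      proof (rule in_W[OF v(2) ballI])
        fix g :: "'a mat" assume g: "g \<in> carrier (GL d)"
        have "\<epsilon>' (ract n d g v) = 0"
          using functional_vanishes_on_orbit[OF \<epsilon>'(1) homog_mat_poly[OF v(1)] zero GL_carrierD[OF g]] .
        thus "\<epsilon> (ract n d g v) = 0" using \<epsilon>'(2)[OF actV[OF g v(2)]] by simp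
      qed
    qed
    hence "ract n d u b - b \<in> W" if "u \<in> upper_unitriangular d" for u
      using graded_stable_subset[OF stable_cochar_stable[OF V] sW _
          ract_upper_unitriangular[OF b that] ub[OF that]] by blast
    thus ?thesis
      by (intro bexI[of _ 0]) (simp_all add: fun_space.subspace_0 sV subspace_homog)
  next
    case False
    \<comment> \<open>All degrees up to \<open>k\<close> lie below the height, so extending
      \<open>\<epsilon>\<close> by \<open>0\<close> to degrees at most \<open>k\<close>, also
      outside \<open>V\<close>, is consistent.\<close>
    have "\<epsilon> v = 0" if "v \<in> V" "v \<in> graded n d {..k}" for v
      using graded_Z[OF that(2,1)] False unfolding Z_def by auto
    then obtain \<epsilon>' where \<epsilon>': "functional \<epsilon>'" "\<And>v. v \<in> V \<Longrightarrow> \<epsilon>' v = \<epsilon> v"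
      "\<And>v. v \<in> graded n d {..k} \<Longrightarrow> \<epsilon>' v = 0"
      using functional_extension[OF sV subspace_graded[of n d "{..k}"] add scale] by metis
    note eps'D = functionalD[OF \<epsilon>'(1)]
    \<comment> \<open>The matrix coefficient of \<open>b\<close>, which need not belong to
      \<open>V\<close>; this is why the total functional \<open>\<epsilon>'\<close> is
      required.\<close>
    obtain p where p: "p \<in> mat_poly_funs d d"
      "\<And>g. g \<in> carrier_mat d d \<Longrightarrow> \<epsilon>' (ract n d g b) = p g"
      using matrix_coefficient_poly[OF bR \<epsilon>'(1)] by metis
    \<comment> \<open>Write the translate of \<open>b\<close> by \<open>u\<close> as its change plus
      \<open>b\<close>. The part coming from \<open>b\<close> stays in degrees at most
      \<open>k\<close> under \<open>t\<close> and \<open>l\<close> and is killed; the change lies in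
      \<open>V\<close>, where \<open>\<epsilon>\<close> is equivariant.\<close>
    have p_cell: "p (l * t * u) = weight d a t * \<epsilon> (ract n d u b - b)"
      if ltu: "l \<in> lower_unitriangular d" "t \<in> torus d" "u \<in> upper_unitriangular d" for l t u
    proof -
      have "l * t * u \<in> carrier_mat d d"
        by (intro GL_carrierD GL_mult lG tG uG ltu)
      hence "p (l * t * u) = \<epsilon>' (ract n d l (ract n d t ((ract n d u b - b) + b)))"
        using p(2) cell[OF ltu] unfolding diff_add_cancel by metis
      also have "\<dots> = \<epsilon>' (ract n d l (ract n d t (ract n d u b - b))) + \<epsilon>' (ract n d l (ract n d t b))"
        unfolding ract_add eps'D ..
      also have "\<epsilon>' (ract n d l (ract n d t b)) = 0"
        by (intro \<epsilon>'(3) ract_lower_unitriangular ract_torus_homog ltu b)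
      also have "\<epsilon>' (ract n d l (ract n d t (ract n d u b - b))) = \<epsilon> (ract n d l (ract n d t (ract n d u b - b)))"
        by (intro \<epsilon>'(2) actV lG tG ltu ub)
      also have "\<dots> = weight d a t * \<epsilon> (ract n d u b - b)"
        using lower[OF ltu(1) actV[OF tG[OF ltu(2)] ub[OF ltu(3)]]] torus[OF ltu(2) ub[OF ltu(3)]] by simp
      finally show ?thesis by simp
    qed
    have p_lower: "p (l0 * x) = p x" if l0: "l0 \<in> lower_unitriangular d" and x: "x \<in> carrier_mat d d" for l0 x
    proof -
      have "p (l0 * x) = 1 * p x"
      proof (rule big_cell_mult[OF p(1) GL_carrierD[OF lG[OF l0]] _ x])
        fix l t u :: "'a mat"
        assume ltu: "l \<in> lower_unitriangular d" "t \<in> torus d" "u \<in> upper_unitriangular d"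
        have "l0 * (l * t * u) = (l0 * l) * t * u"
          using lG[OF l0] lG[OF ltu(1)] tG[OF ltu(2)] uG[OF ltu(3)] by (simp add: assoc_mult_mat[of _ d d _ d _ d])
        thus "p (l0 * (l * t * u)) = 1 * p (l * t * u)"
          using p_cell[OF lower_unitriangular_mult[OF l0 ltu(1)] ltu(2,3)] p_cell[OF ltu] by simp
      qed
      thus ?thesis by simp
    qed
    have p_torus: "p (t0 * x) = weight d a t0 * p x" if t0: "t0 \<in> torus d" and x: "x \<in> carrier_mat d d" for t0 x
    proof (rule big_cell_mult[OF p(1) GL_carrierD[OF tG[OF t0]] _ x])
      fix l t u :: "'a mat"
      assume ltu: "l \<in> lower_unitriangular d" "t \<in> torus d" "u \<in> upper_unitriangular d"
      \<comment> \<open>Moving \<open>t0\<close> past \<open>l\<close> returns the product to big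
        cell form, where \<open>p_cell\<close> applies.\<close>
      obtain l' where l': "l' \<in> lower_unitriangular d" "t0 * l = l' * t0"
        using torus_conj_lower[OF t0 ltu(1)] by blast
      have "t0 * (l * t * u) = (t0 * l) * t * u"
        using tG[OF t0] lG[OF ltu(1)] tG[OF ltu(2)] uG[OF ltu(3)] by (simp add: assoc_mult_mat[of _ d d _ d _ d])
      also have "\<dots> = l' * (t0 * t) * u"
        unfolding l'(2) using tG[OF t0] lG[OF l'(1)] tG[OF ltu(2)] uG[OF ltu(3)]
        by (simp add: assoc_mult_mat[of _ d d _ d _ d])
      finally have eq: "t0 * (l * t * u) = l' * (t0 * t) * u" .
      show "p (t0 * (l * t * u)) = weight d a t0 * p (l * t * u)"
        unfolding eq p_cell[OF l'(1) torus_mult(1)[OF t0 ltu(2)] ltu(3)] p_cell[OF ltu]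
          torus_mult(2)[OF t0 ltu(2)] by (rule mult.assoc)
    qed
    define f where "f = fun_on (carrier (GL d)) (\<lambda>g. p (inv\<^bsub>GL d\<^esub> g))"
    have fY: "f \<in> Y_module d a"
      unfolding Y_module_def funs_mod_lower_unitriangular_def mem_Collect_eq
    proof (intro conjI ballI ext)
      show "f \<in> GL_regular_funs d" unfolding f_def by (rule GL_regular_inv[OF p(1)])
    next
      fix l g :: "'a mat" assume l: "l \<in> lower_unitriangular d"
      show "right_transl (carrier (GL d)) l f g = f g"
      proof (cases "g \<in> carrier (GL d)")
        case True
        let ?x = "inv\<^bsub>GL d\<^esub> (g * l)"
        have gl: "g * l \<in> carrier (GL d)" by (intro GL_mult True lG l)
        have "l * ?x = inv\<^bsub>GL d\<^esub> g"
        proof -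
          have "l * ?x = (l * inv\<^bsub>GL d\<^esub> l) * inv\<^bsub>GL d\<^esub> g"
            unfolding GL_inv_mult[OF True lG[OF l]]
            using GL_carrierD[OF lG[OF l]] GL_carrierD[OF GL_inv(1)[OF True]] GL_carrierD[OF GL_inv(1)[OF lG[OF l]]]
            by (simp add: assoc_mult_mat[of _ d d _ d _ d])
          thus ?thesis using GL_carrierD[OF GL_inv(1)[OF True]] lG[OF l] by simp
        qed
        hence "p ?x = p (inv\<^bsub>GL d\<^esub> g)" using p_lower[OF l GL_carrierD[OF GL_inv(1)[OF gl]]] by simp
        thus ?thesis using True gl by (simp add: f_def right_transl_def)
      qed (simp add: f_def right_transl_def)
    next
      fix t g :: "'a mat" assume t: "t \<in> torus d"
      show "right_transl (carrier (GL d)) t f g = fscale (inverse (weight d a t)) f g"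
      proof (cases "g \<in> carrier (GL d)")
        case True
        let ?x = "inv\<^bsub>GL d\<^esub> (g * t)"
        have gt: "g * t \<in> carrier (GL d)" by (intro GL_mult True tG t)
        have "t * ?x = inv\<^bsub>GL d\<^esub> g"
        proof -
          have "t * ?x = (t * inv\<^bsub>GL d\<^esub> t) * inv\<^bsub>GL d\<^esub> g"
            unfolding GL_inv_mult[OF True tG[OF t]]
            using GL_carrierD[OF tG[OF t]] GL_carrierD[OF GL_inv(1)[OF True]] GL_carrierD[OF GL_inv(1)[OF tG[OF t]]]
            by (simp add: assoc_mult_mat[of _ d d _ d _ d])
          thus ?thesis using GL_carrierD[OF GL_inv(1)[OF True]] tG[OF t] by simp
        qed
        hence "weight d a t * p ?x = p (inv\<^bsub>GL d\<^esub> g)"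
          using p_torus[OF t GL_carrierD[OF GL_inv(1)[OF gt]]] by simp
        hence "p ?x = inverse (weight d a t) * p (inv\<^bsub>GL d\<^esub> g)"
          using weight_nonzero[OF t, of a] by (simp add: field_simps)
        thus ?thesis using True gt by (simp add: f_def right_transl_def fscale_apply)
      qed (simp add: f_def right_transl_def fscale_apply)
    qed
    \<comment> \<open>Surjectivity onto \<open>Y_module d a\<close> provides an element of
      \<open>V\<close> with the same matrix coefficient as \<open>b\<close>.\<close>
    obtain w where w: "w \<in> V" "\<And>g. g \<in> carrier (GL d) \<Longrightarrow> \<epsilon> (ract n d (inv\<^bsub>GL d\<^esub> g) w) = f g"
      using surj[OF fY] by metis
    have w_eq: "\<epsilon>' (ract n d g w) = \<epsilon>' (ract n d g b)" if g: "g \<in> carrier (GL d)" for g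
    proof -
      have "\<epsilon>' (ract n d g w) = \<epsilon> (ract n d (inv\<^bsub>GL d\<^esub> (inv\<^bsub>GL d\<^esub> g)) w)"
        using \<epsilon>'(2)[OF actV[OF g w(1)]] g by simp
      also have "\<dots> = f (inv\<^bsub>GL d\<^esub> g)" by (rule w(2)[OF GL_inv(1)[OF g]])
      also have "\<dots> = p g" using g by (simp add: f_def)
      also have "\<dots> = \<epsilon>' (ract n d g b)" using p(2)[OF GL_carrierD[OF g]] by simp
      finally show ?thesis .
    qed
    \<comment> \<open>The element \<open>w\<close> need not be homogeneous. Since \<open>X\<close>
      is stable under the cocharacter, \<open>homogeneous_correction\<close> will replace it by one
      of degree \<open>k\<close>.\<close>
    define X where "X = {x \<in> mat_poly_funs n d. \<forall>u\<in>upper_unitriangular d. ract n d u x - x \<in> W}"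
    have "b - w \<in> X"
      unfolding X_def mem_Collect_eq
    proof (intro conjI ballI)
      show "b - w \<in> mat_poly_funs n d" using w(1) VR by (intro mat_poly_diff bR) blast
      fix u :: "'a mat" assume u: "u \<in> upper_unitriangular d"
      have eq: "ract n d u (b - w) - (b - w) = (ract n d u b - b) - (ract n d u w - w)"
        unfolding ract_diff by (simp only: diff_diff_eq2 diff_diff_eq add_diff_eq diff_add_eq add.commute add.left_commute)
      show "ract n d u (b - w) - (b - w) \<in> W"
      \<comment> \<open>Translating by \<open>g\<close> yields matrix coefficients at
        \<open>g * u\<close> and at \<open>g\<close>; those of \<open>b\<close> and \<open>w\<close>
        cancel in pairs by \<open>w_eq\<close>.\<close>
      proof (rule in_W[OF _ ballI])
        show "ract n d u (b - w) - (b - w) \<in> V"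
          unfolding eq by (intro fun_space.subspace_diff[OF sV] ub u actV uG w(1))
        fix g :: "'a mat" assume g: "g \<in> carrier (GL d)"
        note gC = GL_carrierD[OF g] and uC = GL_carrierD[OF uG[OF u]]
        have "ract n d g (ract n d u (b - w) - (b - w)) \<in> V"
          unfolding eq by (intro actV fun_space.subspace_diff[OF sV] ub u g uG w(1))
        hence "\<epsilon> (ract n d g (ract n d u (b - w) - (b - w))) = \<epsilon>' (ract n d g (ract n d u (b - w) - (b - w)))"
          using \<epsilon>'(2) by simp
        also have "\<dots> = (\<epsilon>' (ract n d (g * u) b) - \<epsilon>' (ract n d (g * u) w))
            - (\<epsilon>' (ract n d g b) - \<epsilon>' (ract n d g w))"
          unfolding ract_diff eps'D ract_ract[OF gC uC] ..
        also have "\<dots> = 0" using w_eq[OF g] w_eq[OF GL_mult[OF g uG[OF u]]] by simp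
        finally show "\<epsilon> (ract n d g (ract n d u (b - w) - (b - w))) = 0" .
      qed
    qed
    moreover have "cochar_stable n d X"
      unfolding cochar_stable_def
    proof (intro conjI allI impI ballI)
      show "fun_space.subspace X"
      proof (rule fun_space.subspaceI)
        show "0 \<in> X"
          unfolding X_def mem_Collect_eq ract_zero diff_self
          by (intro conjI ballI mat_poly_zero fun_space.subspace_0[OF sW])
      next
        fix x y assume xy: "x \<in> X" "y \<in> X"
        have "ract n d u (x + y) - (x + y) \<in> W" if "u \<in> upper_unitriangular d" for u
        proof -
          have "(ract n d u x - x) + (ract n d u y - y) \<in> W"
            using xy that unfolding X_def by (intro fun_space.subspace_add[OF sW]) blast+
          thus ?thesis unfolding ract_add add_diff_add .
        qed
        thus "x + y \<in> X" using xy mat_poly_add unfolding X_def by blast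
      next
        fix c x assume x: "x \<in> X"
        have "ract n d u (fscale c x) - fscale c x \<in> W" if "u \<in> upper_unitriangular d" for u
        proof -
          have "fscale c (ract n d u x - x) \<in> W"
            using x that unfolding X_def by (intro fun_space.subspace_scale[OF sW]) blast
          thus ?thesis unfolding ract_scale fun_space.scale_right_diff_distrib .
        qed
        thus "fscale c x \<in> X" using x mat_poly_scale unfolding X_def by blast
      qed
      fix s :: 'a and x assume s: "s \<noteq> 0" and x: "x \<in> X"
      note cT = cochar_torus[OF s, of d] and cG = cochar_GL[OF s, of d]
      have "ract n d u (ract n d (cochar d s) x) - ract n d (cochar d s) x \<in> W"
        if u: "u \<in> upper_unitriangular d" for u
      proof -
        \<comment> \<open>The torus normalizes the unipotent group, so the condition for
          \<open>u\<close> after translation is the one for \<open>u'\<close> before it.\<close>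
        obtain u' where u': "u' \<in> upper_unitriangular d" "u * cochar d s = cochar d s * u'"
          using torus_conj_upper[OF cT u] by blast
        have "ract n d (cochar d s) (ract n d u' x - x) \<in> W"
          using x u'(1) unfolding X_def by (intro actW cG) blast
        thus ?thesis
          unfolding ract_diff ract_ract[OF cochar_carrier GL_carrierD[OF uG[OF u'(1)]]]
            ract_ract[OF GL_carrierD[OF uG[OF u]] cochar_carrier] u'(2) .
      qed
      moreover have "ract n d (cochar d s) x \<in> mat_poly_funs n d"
        using x unfolding X_def by (intro ract_mat_poly cochar_carrier) blast
      ultimately show "ract n d (cochar d s) x \<in> X" unfolding X_def by blast
    qed
    ultimately obtain w' where "w' \<in> V \<inter> homog n d k" "b - w' \<in> X"
      using homogeneous_correction[OF stable_cochar_stable[OF V] VR _ b w(1)] by blast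
    thus ?thesis unfolding X_def by blast
  qed
qed

section \<open>Modules with a good filtration are determined by their highest weight vectors\<close>

lemma homog_disjoint:
  fixes F :: "'a::alg_closed_field mat \<Rightarrow> 'a"
  assumes "F \<in> homog n d k" "F \<in> homog n d l" "k \<noteq> l"
  shows "F = 0"
proof -
  obtain s :: 'a where s: "s \<noteq> 0" "s ^ k \<noteq> s ^ l" using exists_separating_scalar[OF assms(3)] by metis
  have "fscale (s ^ k) F = fscale (s ^ l) F" using assms(1,2) s(1) unfolding homog_def by force
  hence "s ^ k * F x = s ^ l * F x" for x using fscale_apply by metis
  thus ?thesis using s(2) by (intro ext) simp
qed

lemma stable_span_orbit:
  assumes "F \<in> mat_poly_funs n d"
  shows "stable_subspace d (ract n d) (fun_space.span ((\<lambda>g. ract n d g F) ` carrier (GL d)))"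
    (is "stable_subspace _ _ ?M")
  unfolding stable_subspace_def
proof (intro conjI ballI)
  show "fun_space.subspace ?M" by (rule fun_space.subspace_span)
  fix g :: "'a mat" and v assume g: "g \<in> carrier (GL d)" and v: "v \<in> ?M"
  have "fun_space.subspace {v. ract n d g v \<in> ?M}"
    by (rule fun_space.subspaceI)
       (simp_all only: mem_Collect_eq ract_zero ract_add ract_scale
          fun_space.span_zero fun_space.span_add fun_space.span_scale)
  moreover have "(\<lambda>g. ract n d g F) ` carrier (GL d) \<subseteq> {v. ract n d g v \<in> ?M}"
  proof
    fix w assume "w \<in> (\<lambda>g. ract n d g F) ` carrier (GL d)"
    then obtain h where h: "h \<in> carrier (GL d)" "w = ract n d h F" by blast
    have "ract n d g w = ract n d (g * h) F"
      unfolding h(2) by (rule ract_ract[OF GL_carrierD[OF g] GL_carrierD[OF h(1)]])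
    also have "\<dots> \<in> ?M" by (intro fun_space.span_base imageI GL_mult g h(1))
    finally show "w \<in> {v. ract n d g v \<in> ?M}" by blast
  qed
  ultimately have "?M \<subseteq> {v. ract n d g v \<in> ?M}" by (intro fun_space.span_minimal)
  thus "ract n d g v \<in> ?M" using v by blast
qed

text \<open>Supplies the upper bound on degrees from which the descending induction in
  \<open>good_filtration_eqI\<close> starts.\<close>

lemma finite_set_bounded_degree:
  assumes "finite S" "S \<subseteq> mat_poly_funs n d"
  shows "\<exists>K. S \<subseteq> graded n d {..K::nat}"
  using assms
proof (induction S rule: finite_induct)
  case (insert F S)
  then obtain K where K: "S \<subseteq> graded n d {..K}" by blast
  have "F \<in> graded n d UNIV" using insert.prems by (intro mat_poly_graded) blast
  then obtain I f where f: "finite I" "\<forall>l. f l \<in> homog n d l" "F = sum f I"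
    using graded_sum[of F n d UNIV] by metis
  define K' where "K' = Max (insert K I)"
  have K': "K \<le> K'" "\<And>l. l \<in> I \<Longrightarrow> l \<le> K'" using f(1) by (auto simp: K'_def)
  have "F \<in> graded n d {..K'}"
    unfolding f(3)
  proof (rule fun_space.subspace_sum[OF subspace_graded])
    fix l assume "l \<in> I"
    thus "f l \<in> graded n d {..K'}" using f(2) K'(2) by (intro homog_graded[of _ _ _ l]) auto
  qed
  moreover have "graded n d {..K} \<subseteq> graded n d {..K'}" using K'(1) by (intro graded_mono) auto
  ultimately have "insert F S \<subseteq> graded n d {..K'}" using K by (intro insert_subsetI subset_trans[OF K])
  thus ?case by (rule exI)
qed simp

lemma good_filtration_eqI:
  fixes V B :: "('a::alg_closed_field mat \<Rightarrow> 'a) set"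
  assumes gf: "has_good_filtration d (ract n d) V" and sV: "fun_space.subspace V"
    and B: "stable_subspace d (ract n d) B" and VB: "V \<subseteq> B" and BR: "B \<subseteq> mat_poly_funs n d"
    and inv: "\<And>F. F \<in> B \<Longrightarrow> (\<And>u. u \<in> upper_unitriangular d \<Longrightarrow> ract n d u F = F) \<Longrightarrow> F \<in> V"
  shows "V = B"
proof -
  obtain N :: enat and F where F0: "F 0 = {0}"
    and stable: "\<forall>i. enat i \<le> N \<longrightarrow> stable_subspace d (ract n d) (F i)"
    and VF: "V = (\<Union>i\<in>{i. enat i \<le> N}. F i)"
    and filt: "\<forall>i. enat (Suc i) \<le> N \<longrightarrow> F i \<subseteq> F (Suc i) \<and>
      (\<exists>a. dominant d a \<and> quotient_isomorphic d (ract n d) (F (Suc i)) (F i)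
         (left_transl d (carrier (GL d))) (Y_module d a))"
    using gf unfolding has_good_filtration_def by (elim exE conjE) (rule that)
  note stable = stable[rule_format]
  have incr: "F i \<subseteq> F (Suc i)" if "enat (Suc i) \<le> N" for i
    using filt that by (simp only:)
  have le_N: "enat i \<le> N" if "enat (Suc i) \<le> N" for i
    using that by (intro order_trans[of "enat i" "enat (Suc i)" N]) simp
  have sB: "fun_space.subspace B"
    and actB: "\<And>g v. g \<in> carrier (GL d) \<Longrightarrow> v \<in> B \<Longrightarrow> ract n d g v \<in> B"
    using B by (auto simp only: stable_subspace_def)
  note uG = upper_unitriangular_GL
  have FV: "F i \<subseteq> V" if "enat i \<le> N" for i using that VF by blast
  \<comment> \<open>Induction on the filtration level: at level \<open>0\<close> the vector is fixed
    by all \<open>u\<close>, and \<open>filtration_step\<close> lowers the level by one at the cost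
    of an element of \<open>V\<close>.\<close>
  have descend: "b \<in> V" if "enat i \<le> N" "b \<in> B" "b \<in> homog n d k"
    "\<And>u. u \<in> upper_unitriangular d \<Longrightarrow> ract n d u b - b \<in> F i" for i b k
    using that
  proof (induction i arbitrary: b)
    case 0
    have "ract n d u b = b" if "u \<in> upper_unitriangular d" for u
    proof -
      have "ract n d u b - b = 0" using 0(4)[OF that] unfolding F0 by (rule singletonD)
      thus ?thesis by (rule iffD2[OF eq_iff_diff_eq_0])
    qed
    thus "b \<in> V" using inv[OF 0(2)] by blast
  next
    case (Suc i)
    have i: "enat i \<le> N" by (rule le_N[OF Suc.prems(1)])
    obtain a where iso: "quotient_isomorphic d (ract n d) (F (Suc i)) (F i)
         (left_transl d (carrier (GL d))) (Y_module d a)"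
      using filt[rule_format, OF Suc.prems(1)] by (elim conjE exE) (rule that)
    have FR: "F (Suc i) \<subseteq> mat_poly_funs n d" using FV[OF Suc.prems(1)] VB BR by blast
    have "\<exists>w\<in>F (Suc i) \<inter> homog n d k. \<forall>u\<in>upper_unitriangular d. ract n d u (b - w) - (b - w) \<in> F i"
      by (rule filtration_step[OF stable[OF Suc.prems(1)] stable[OF i] FR iso Suc.prems(3)])
         (rule Suc.prems(4))
    then obtain w where w: "w \<in> F (Suc i) \<inter> homog n d k"
      "\<forall>u\<in>upper_unitriangular d. ract n d u (b - w) - (b - w) \<in> F i" by (rule bexE)
    have wV: "w \<in> V" using w(1) FV[OF Suc.prems(1)] by (elim IntE) (rule subsetD)
    have "b - w \<in> V"
    proof (rule Suc.IH[OF i])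
      show "b - w \<in> B" using wV VB by (intro fun_space.subspace_diff[OF sB] Suc.prems(2)) blast
      show "b - w \<in> homog n d k" by (intro fun_space.subspace_diff[OF subspace_homog] Suc.prems(3) IntD2[OF w(1)])
    qed (rule bspec[OF w(2)])
    hence "(b - w) + w \<in> V" using wV by (intro fun_space.subspace_add[OF sV])
    thus "b \<in> V" unfolding diff_add_cancel .
  qed
  have mono: "F i \<subseteq> F j" if "i \<le> j" "enat j \<le> N" for i j
    using that
  proof (induction j rule: dec_induct)
    case (step j)
    show ?case by (rule subset_trans[OF step.IH[OF le_N[OF step.prems]] incr[OF step.prems]])
  qed simp
  have finite_level: "\<exists>i. enat i \<le> N \<and> S \<subseteq> F i" if "finite S" "S \<subseteq> V" for S
    using that
  proof (induction S rule: finite_induct)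
    case empty
    show ?case by (intro exI[of _ 0]) (simp flip: zero_enat_def)
  next
    case (insert v S)
    then obtain i j where ij: "enat i \<le> N" "S \<subseteq> F i" "enat j \<le> N" "v \<in> F j" using VF by blast
    hence "enat (max i j) \<le> N" by (simp add: max_def)
    thus ?case using ij mono[of i "max i j"] mono[of j "max i j"] by (intro exI[of _ "max i j"]) auto
  qed
  \<comment> \<open>The changes of \<open>b\<close> under all \<open>u\<close> span a
    finite-dimensional space, so a single level \<open>F i\<close> contains them and
    \<open>descend\<close> applies.\<close>
  have highest: "b \<in> V" if b: "b \<in> B" "b \<in> homog n d k"
    and ub: "\<And>u. u \<in> upper_unitriangular d \<Longrightarrow> ract n d u b - b \<in> V" for b k
  proof -
    obtain S where S: "S \<subseteq> mat_poly_funs n d" "finite S"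
      "\<forall>g\<in>carrier_mat d d. ract n d g b \<in> fun_space.span S"
      using orbit_finite_dimensional[OF homog_mat_poly[OF b(2)]] by blast
    define D where "D = (\<lambda>u. ract n d u b - b) ` upper_unitriangular d"
    have "b \<in> fun_space.span S"
      using S(3) ract_one[OF homog_mat_poly[OF b(2)]] by (metis one_carrier_mat)
    hence "ract n d u b - b \<in> fun_space.span S" if "u \<in> upper_unitriangular d" for u
      using S(3) GL_carrierD[OF uG[OF that]] by (intro fun_space.span_diff) blast
    hence DS: "D \<subseteq> fun_space.span S" unfolding D_def by blast
    \<comment> \<open>\<open>D\<close> itself may be infinite; a basis of its span is finite because
      it lies in the span of \<open>S\<close>.\<close>
    obtain E where E: "E \<subseteq> D" "fun_space.independent E" "D \<subseteq> fun_space.span E"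
      using fun_space.maximal_independent_subset by blast
    have "finite E" using fun_space.independent_span_bound[OF S(2) E(2)] E(1) DS by blast
    moreover have "E \<subseteq> V" using E(1) ub unfolding D_def by blast
    ultimately obtain i where i: "enat i \<le> N" "E \<subseteq> F i" using finite_level by blast
    have "fun_space.subspace (F i)" using stable[OF i(1)] unfolding stable_subspace_def by blast
    hence "D \<subseteq> F i" using E(3) fun_space.span_minimal[OF i(2)] by blast
    hence "ract n d u b - b \<in> F i" if "u \<in> upper_unitriangular d" for u using that unfolding D_def by blast
    thus ?thesis by (rule descend[OF i(1) b])
  qed
  have "b0 \<in> V" if b0: "b0 \<in> B" for b0
  proof -
    have b0R: "b0 \<in> mat_poly_funs n d" using b0 BR by blast
    \<comment> \<open>The submodule generated by \<open>b0\<close> has bounded degrees, which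
      \<open>B\<close> as a whole need not have.\<close>
    define M where "M = fun_space.span ((\<lambda>g. ract n d g b0) ` carrier (GL d))"
    have M: "stable_subspace d (ract n d) M" unfolding M_def by (rule stable_span_orbit[OF b0R])
    have sM: "fun_space.subspace M" using M by (simp only: stable_subspace_def)
    have MB: "M \<subseteq> B" unfolding M_def using actB b0 by (intro fun_space.span_minimal sB) blast
    obtain S where S: "S \<subseteq> mat_poly_funs n d" "finite S"
      "\<forall>g\<in>carrier_mat d d. ract n d g b0 \<in> fun_space.span S"
      using orbit_finite_dimensional[OF b0R] by blast
    obtain K where K: "S \<subseteq> graded n d {..K}" using finite_set_bounded_degree[OF S(2,1)] by blast
    have "fun_space.span S \<subseteq> graded n d {..K}" by (intro fun_space.span_minimal K subspace_graded)
    hence "(\<lambda>g. ract n d g b0) ` carrier (GL d) \<subseteq> graded n d {..K}" using S(3) GL_carrierD by blast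
    hence MK: "M \<subseteq> graded n d {..K}" unfolding M_def by (intro fun_space.span_minimal subspace_graded)
    have pieces: "homog n d k \<inter> M \<subseteq> V" for k
    \<comment> \<open>Descending induction on the degree: \<open>u\<close> changes a vector of
      degree \<open>k\<close> only in higher degrees, which are already settled. Degrees above
      \<open>K\<close> have measure \<open>0\<close> and contain only the zero vector of
      \<open>M\<close>.\<close>
    proof (induction "Suc K - k" arbitrary: k rule: less_induct)
      case less
      show ?case
      proof
        fix b assume "b \<in> homog n d k \<inter> M"
        hence b: "b \<in> homog n d k" "b \<in> M" by auto
        show "b \<in> V"
        proof (cases "k \<le> K")
          case True
          have "ract n d u b - b \<in> V" if u: "u \<in> upper_unitriangular d" for u
          proof (rule graded_stable_subset[OF stable_cochar_stable[OF M] sV _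
                ract_upper_unitriangular[OF b(1) u]])
            show "homog n d l \<inter> M \<subseteq> V" if "l \<in> {k<..}" for l
              by (rule less) (use that True in auto)
            have "ract n d u b \<in> M" using M b(2) uG[OF u] unfolding stable_subspace_def by blast
            thus "ract n d u b - b \<in> M" by (rule fun_space.subspace_diff[OF sM _ b(2)])
          qed
          thus ?thesis using highest[of b k] b MB by blast
        next
          case False
          \<comment> \<open>A subspace of pure degree \<open>k\<close> meets every degree up to
            \<open>K\<close> only in \<open>0\<close>, whereas \<open>M\<close> lives in those
            degrees.\<close>
          let ?H = "homog n d k :: ('a mat \<Rightarrow> 'a) set"
          have "cochar_stable n d ?H"
            unfolding cochar_stable_def
            by (intro conjI allI impI ballI subspace_homog ract_torus_homog cochar_torus)
          moreover have "homog n d l \<inter> ?H \<subseteq> {0}" if "l \<in> {..K}" for l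
          proof
            have "l \<noteq> k" using that False by auto
            fix G assume "G \<in> homog n d l \<inter> ?H"
            hence "G = 0" using homog_disjoint[OF _ _ \<open>l \<noteq> k\<close>] by (elim IntE)
            thus "G \<in> {0}" by (simp only: singleton_iff)
          qed
          ultimately have "b \<in> {0}"
            using b MK by (intro graded_stable_subset[OF _ fun_space.subspace_single_0, of n d ?H "{..K}" b]) auto
          thus ?thesis using fun_space.subspace_0[OF sV] by simp
        qed
      qed
    qed
    have "ract n d (1\<^sub>m d) b0 \<in> M" unfolding M_def by (intro fun_space.span_base imageI GL_one)
    hence "b0 \<in> M" unfolding ract_one[OF b0R] .
    thus "b0 \<in> V"
      using graded_stable_subset[OF stable_cochar_stable[OF M] sV _ mat_poly_graded[OF b0R]] pieces by blast
  qed
  thus ?thesis using VB by blast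
qed


section \<open>Highest weight vectors among vector invariants\<close>

lemma left_transl_apply [simp]:
  "x \<in> carrier_mat n d \<Longrightarrow> left_transl n (carrier_mat n d) h F x = F (inv\<^bsub>GL n\<^esub> h * x)"
  "x \<notin> carrier_mat n d \<Longrightarrow> left_transl n (carrier_mat n d) h F x = 0"
  by (simp_all add: left_transl_def)

lemma invariants_iff:
  assumes "H \<subseteq> carrier (GL n)"
  shows "F \<in> invariants n d H \<longleftrightarrow> F \<in> mat_poly_funs n d \<and>
    (\<forall>h\<in>H. \<forall>x\<in>carrier_mat n d. F (inv\<^bsub>GL n\<^esub> h * x) = F x)"
proof -
  have "left_transl n (carrier_mat n d) h F = F \<longleftrightarrow> (\<forall>x\<in>carrier_mat n d. F (inv\<^bsub>GL n\<^esub> h * x) = F x)"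
    if "F \<in> mat_poly_funs n d" for h
  proof
    assume "left_transl n (carrier_mat n d) h F = F"
    thus "\<forall>x\<in>carrier_mat n d. F (inv\<^bsub>GL n\<^esub> h * x) = F x" by (metis left_transl_apply(1))
  next
    assume *: "\<forall>x\<in>carrier_mat n d. F (inv\<^bsub>GL n\<^esub> h * x) = F x"
    show "left_transl n (carrier_mat n d) h F = F"
    proof
      fix x show "left_transl n (carrier_mat n d) h F x = F x"
        using * mat_poly_outside[OF that] by (cases "x \<in> carrier_mat n d") simp_all
    qed
  qed
  thus ?thesis unfolding invariants_def by blast
qed

text \<open>Left and right multiplication commute by associativity.\<close>

lemma stable_invariants:
  assumes H: "H \<subseteq> carrier (GL n)"
  shows "stable_subspace d (ract n d) (invariants n d H)"
  unfolding stable_subspace_def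
proof (intro conjI ballI)
  note iff = invariants_iff[OF H]
  show "fun_space.subspace (invariants n d H)"
    by (rule fun_space.subspaceI)
       (auto simp only: iff mat_poly_zero mat_poly_add mat_poly_scale zero_fun_apply plus_fun_apply fscale_apply)
  fix g :: "'a mat" and F assume g: "g \<in> carrier (GL d)" and F: "F \<in> invariants n d H"
  note gC = GL_carrierD[OF g]
  show "ract n d g F \<in> invariants n d H"
    unfolding iff
  proof (intro conjI ballI)
    show "ract n d g F \<in> mat_poly_funs n d" using F unfolding iff by (intro ract_mat_poly gC) blast
    fix h x :: "'a mat" assume h: "h \<in> H" and x: "x \<in> carrier_mat n d"
    have hC: "inv\<^bsub>GL n\<^esub> h \<in> carrier_mat n n" using h H by (intro GL_carrierD GL_inv(1)) blast
    have xg: "x * g \<in> carrier_mat n d" by (rule mult_carrier_mat[OF x gC])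
    have "ract n d g F (inv\<^bsub>GL n\<^esub> h * x) = F (inv\<^bsub>GL n\<^esub> h * (x * g))"
      using ract_apply(1)[OF mult_carrier_mat[OF hC x]] assoc_mult_mat[OF hC x gC] by metis
    also have "\<dots> = F (x * g)" using F h xg unfolding iff by blast
    finally show "ract n d g F (inv\<^bsub>GL n\<^esub> h * x) = ract n d g F x" using ract_apply(1)[OF x] by metis
  qed
qed

lemma first_columns_mult:
  assumes "A \<in> carrier_mat n n" "x \<in> carrier_mat n d" "n \<le> d"
  shows "first_columns n (A * x) = A * first_columns n x"
  using assms by (intro eq_matI) (auto simp: first_columns_def scalar_prod_def)

lemma j_map_invariants:
  assumes H: "H \<subseteq> carrier (GL n)" and nd: "n \<le> d" and f: "f \<in> invariants n n H"
  shows "j_map n d f \<in> invariants n d H"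
  unfolding invariants_iff[OF H]
proof (intro conjI ballI)
  have fR: "f \<in> mat_poly_funs n n" using f unfolding invariants_iff[OF H] by blast
  show "j_map n d f \<in> mat_poly_funs n d"
    unfolding j_map_def by (rule mat_poly_compose[OF fR mat_poly_map_first_columns[OF order_refl nd]])
  fix h x :: "'a mat" assume h: "h \<in> H" and x: "x \<in> carrier_mat n d"
  have hC: "inv\<^bsub>GL n\<^esub> h \<in> carrier_mat n n" using h H by (intro GL_carrierD GL_inv(1)) blast
  have "f (inv\<^bsub>GL n\<^esub> h * first_columns n x) = f (first_columns n x)"
    using f h first_columns_carrier unfolding invariants_iff[OF H] by blast
  thus "j_map n d f (inv\<^bsub>GL n\<^esub> h * x) = j_map n d f x"
    using x mult_carrier_mat[OF hC x] by (simp add: j_map_def first_columns_mult[OF hC x nd])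
qed

lemma polarization_subset_invariants:
  assumes H: "H \<subseteq> carrier (GL n)" and nd: "n \<le> d"
  shows "polarization_algebra n d (H :: 'a::field mat set) \<subseteq> invariants n d H"
proof
  note iff = invariants_iff[OF H]
  fix F assume "F \<in> polarization_algebra n d H"
  thus "F \<in> invariants n d H"
    unfolding polarization_algebra_def
  proof (induction rule: generated_algebra.induct)
    case (const c)
    have "fun_on (carrier_mat n d) (\<lambda>_. c) \<in> invariants n d H"
      unfolding iff
    proof (intro conjI ballI mat_poly_const)
      fix h x :: "'a mat" assume h: "h \<in> H" and x: "x \<in> carrier_mat n d"
      have "inv\<^bsub>GL n\<^esub> h \<in> carrier_mat n n" using h H by (intro GL_carrierD GL_inv(1)) blast
      hence "inv\<^bsub>GL n\<^esub> h * x \<in> carrier_mat n d" using x by (rule mult_carrier_mat)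
      thus "fun_on (carrier_mat n d) (\<lambda>_. c) (inv\<^bsub>GL n\<^esub> h * x) = fun_on (carrier_mat n d) (\<lambda>_. c) x"
        using x by simp
    qed
    then show ?case .
  next
    case (gen F)
    then obtain g f where gf: "F = ract n d g (j_map n d f)" "g \<in> carrier (GL d)" "f \<in> invariants n n H"
      by blast
    have "ract n d g (j_map n d f) \<in> invariants n d H"
      using stable_invariants[OF H, of d] gf(2) j_map_invariants[OF H nd gf(3)]
      unfolding stable_subspace_def by blast
    then show ?case unfolding gf(1) .
  next
    case (add F G)
    then show ?case
      using stable_invariants[OF H, of d] unfolding stable_subspace_def
      by (elim conjE) (rule fun_space.subspace_add)
  next
    case (mult F G)
    have "F * G \<in> invariants n d H"
      unfolding iff
    proof (intro conjI ballI)
      show "F * G \<in> mat_poly_funs n d" using mult.IH unfolding iff by (intro mat_poly_mult) blast+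
      fix h x :: "'a mat" assume "h \<in> H" "x \<in> carrier_mat n d"
      hence "F (inv\<^bsub>GL n\<^esub> h * x) = F x" "G (inv\<^bsub>GL n\<^esub> h * x) = G x"
        using mult.IH unfolding iff by blast+
      thus "(F * G) (inv\<^bsub>GL n\<^esub> h * x) = (F * G) x" unfolding times_fun_apply by (rule arg_cong2)
    qed
    then show ?case .
  qed
qed

lemma subspace_polarization_algebra:
  fixes H :: "'a::field mat set"
  assumes "H \<subseteq> carrier (GL n)" "n \<le> d"
  shows "fun_space.subspace (polarization_algebra n d H)"
proof (rule fun_space.subspaceI)
  note const = generated_algebra.const and add = generated_algebra.add and mult = generated_algebra.mult
  have "fun_on (carrier_mat n d) (\<lambda>_. 0) \<in> polarization_algebra n d H"
    unfolding polarization_algebra_def by (rule const)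
  moreover have "fun_on (carrier_mat n d) (\<lambda>_. 0) = (0 :: 'a mat \<Rightarrow> 'a)"
    by (rule ext) (simp add: fun_on_def)
  ultimately show "0 \<in> polarization_algebra n d H" by (simp only:)
  show "F + G \<in> polarization_algebra n d H"
    if "F \<in> polarization_algebra n d H" "G \<in> polarization_algebra n d H" for F G
    using that unfolding polarization_algebra_def by (rule add)
  fix c F assume F: "F \<in> polarization_algebra n d H"
  \<comment> \<open>Needed for vanishing off the carrier, which lets a scalar act as a constant of
    the algebra.\<close>
  have FR: "F \<in> mat_poly_funs n d"
    using subsetD[OF polarization_subset_invariants[OF assms] F] unfolding invariants_def by blast
  have "fscale c F = fun_on (carrier_mat n d) (\<lambda>_. c) * F"
    by (intro ext) (simp add: fun_on_def fscale_apply mat_poly_outside[OF FR])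
  also have "\<dots> \<in> polarization_algebra n d H"
    using F unfolding polarization_algebra_def by (intro mult const)
  finally show "fscale c F \<in> polarization_algebra n d H" .
qed

text \<open>Matrices whose first \<open>n\<close> columns are independent can be brought to the form \<open>(x\<^sub>1,\<dots>,x\<^sub>n,0,\<dots>,0)\<close>
  by a unipotent column operation.\<close>

lemma unipotent_highest_weight:
  fixes F :: "'a::alg_closed_field mat \<Rightarrow> 'a"
  assumes H: "H \<subseteq> carrier (GL n)" and nd: "n \<le> d" and F: "F \<in> invariants n d H"
    and inv: "\<And>u. u \<in> upper_unitriangular d \<Longrightarrow> ract n d u F = F"
  shows "F \<in> polarization_algebra n d H"
proof -
  note iff = invariants_iff[OF H]
  have FR: "F \<in> mat_poly_funs n d" using F unfolding iff by blast
  define pad where "pad y = mat n d (\<lambda>(i, j). if j < n then y $$ (i, j) else 0)" for y :: "'a mat"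
  have padC: "pad y \<in> carrier_mat n d" for y by (simp add: pad_def)
  \<comment> \<open>The candidate preimage of \<open>F\<close> under \<open>j_map\<close>: its
    restriction to matrices whose columns after the first \<open>n\<close> are zero.\<close>
  define f where "f = fun_on (carrier_mat n n) (\<lambda>y. F (pad y))"
  have pad_poly: "mat_poly_map n n n d pad"
    unfolding mat_poly_map_def
  proof (intro conjI ballI allI impI padC)
    fix i j assume ij: "i < n" "j < d"
    show "fun_on (carrier_mat n n) (\<lambda>x. pad x $$ (i, j)) \<in> mat_poly_funs n n"
    proof (cases "j < n")
      case True
      have "fun_on (carrier_mat n n) (\<lambda>x. pad x $$ (i, j)) = fun_on (carrier_mat n n) (\<lambda>x. x $$ (i, j))"
        using ij True by (simp add: pad_def)
      thus ?thesis using mat_poly_entry[OF ij(1) True] by (simp only:)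
    next
      case False
      have "fun_on (carrier_mat n n) (\<lambda>x. pad x $$ (i, j)) = fun_on (carrier_mat n n) (\<lambda>_. 0)"
        using ij False by (simp add: pad_def)
      thus ?thesis using mat_poly_const[of n n 0] by (simp only:)
    qed
  qed
  have fI: "f \<in> invariants n n H"
    unfolding iff
  proof (intro conjI ballI)
    show "f \<in> mat_poly_funs n n" unfolding f_def by (rule mat_poly_compose[OF FR pad_poly])
    fix h y :: "'a mat" assume h: "h \<in> H" and y: "y \<in> carrier_mat n n"
    have hC: "inv\<^bsub>GL n\<^esub> h \<in> carrier_mat n n" using h H by (intro GL_carrierD GL_inv(1)) blast
    have pad_mult: "pad (A * y) = A * pad y" if "A \<in> carrier_mat n n" for A
      using that y by (intro eq_matI) (auto simp: pad_def scalar_prod_def)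
    have "F (inv\<^bsub>GL n\<^esub> h * pad y) = F (pad y)" using F h padC unfolding iff by blast
    thus "f (inv\<^bsub>GL n\<^esub> h * y) = f y"
      using y mult_carrier_mat[OF hC y] by (simp add: f_def pad_mult[OF hC])
  qed
  have jfR: "j_map n d f \<in> mat_poly_funs n d"
    using j_map_invariants[OF H nd fI] unfolding iff by blast
  \<comment> \<open>It suffices to compare both functions where the first \<open>n\<close> columns
    are independent.\<close>
  have "F - j_map n d f = 0"
  proof (rule mat_poly_density)
    show "F - j_map n d f \<in> mat_poly_funs n d" by (rule mat_poly_diff[OF FR jfR])
    let ?Q = "fun_on (carrier_mat n d) (\<lambda>x. det (first_columns n x))"
    show "?Q \<in> mat_poly_funs n d" by (rule mat_poly_leading_minor[OF order_refl nd])
    have "first_columns n (pad (1\<^sub>m n)) = 1\<^sub>m n"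
      using nd by (intro eq_matI) (auto simp: first_columns_def pad_def)
    thus "?Q (pad (1\<^sub>m n)) \<noteq> 0" using padC by simp
    fix x :: "'a mat" assume x: "x \<in> carrier_mat n d" and Qx: "?Q x \<noteq> 0"
    define X where "X = first_columns n x"
    have XG: "X \<in> carrier (GL n)" using x Qx unfolding X_def carrier_GL by simp
    \<comment> \<open>\<open>y\<close> holds the coordinates of the columns of \<open>x\<close> in
      the basis formed by the first \<open>n\<close> of them.\<close>
    define y where "y = inv\<^bsub>GL n\<^esub> X * x"
    have yC: "y \<in> carrier_mat n d"
      unfolding y_def by (rule mult_carrier_mat[OF GL_carrierD[OF GL_inv(1)[OF XG]] x])
    have "X * y = (X * inv\<^bsub>GL n\<^esub> X) * x"
      unfolding y_def by (rule assoc_mult_mat[OF GL_carrierD[OF XG] GL_carrierD[OF GL_inv(1)[OF XG]] x, symmetric])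
    hence Xy: "X * y = x" using x XG by simp
    \<comment> \<open>Right multiplication by \<open>u\<close> subtracts from each later column its
      expression in the first \<open>n\<close> columns.\<close>
    define u where "u = mat d d (\<lambda>(i, j). if i = j then 1 else if i < n \<and> n \<le> j then - y $$ (i, j) else 0)"
    have u: "u \<in> upper_unitriangular d" by (auto simp: u_def upper_unitriangular_def)
    have "x * u = pad X"
    proof (rule eq_matI)
      fix i j assume "i < dim_row (pad X)" "j < dim_col (pad X)"
      hence ij: "i < n" "j < d" by (auto simp: pad_def)
      have "(x * u) $$ (i, j) = (\<Sum>k<d. x $$ (i, k) * u $$ (k, j))"
        using x ij by (auto simp: u_def scalar_prod_def atLeast0LessThan)
      \<comment> \<open>The identity and the correction are separated; they do not overlap, as
        \<open>k < n\<close> and \<open>n \<le> j\<close> exclude \<open>k = j\<close>.\<close>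
      also have "\<dots> = (\<Sum>k<d. (if k = j then x $$ (i, k) else 0) +
          (if k < n then (if n \<le> j then - (x $$ (i, k) * y $$ (k, j)) else 0) else 0))"
        using ij by (intro sum.cong) (auto simp: u_def)
      also have "\<dots> = x $$ (i, j) + (\<Sum>k<d. if k < n then (if n \<le> j then - (x $$ (i, k) * y $$ (k, j)) else 0) else 0)"
        unfolding sum.distrib using ij by simp
      also have "(\<Sum>k<d. if k < n then (if n \<le> j then - (x $$ (i, k) * y $$ (k, j)) else 0) else 0)
          = (\<Sum>k<n. if n \<le> j then - (x $$ (i, k) * y $$ (k, j)) else 0)"
        using nd by (intro sum.mono_neutral_cong_right) auto
      also have "\<dots> = (if n \<le> j then - (\<Sum>k<n. x $$ (i, k) * y $$ (k, j)) else 0)"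
        by (simp add: sum_negf)
      also have "(\<Sum>k<n. x $$ (i, k) * y $$ (k, j)) = (X * y) $$ (i, j)"
        using ij yC by (auto simp: X_def first_columns_def scalar_prod_def atLeast0LessThan)
      finally show "(x * u) $$ (i, j) = pad X $$ (i, j)"
        using ij unfolding Xy by (auto simp: pad_def X_def first_columns_def)
    qed (use x in \<open>auto simp: pad_def u_def\<close>)
    hence "F x = F (pad X)" using inv[OF u] ract_apply(1)[OF x] by metis
    also have "\<dots> = j_map n d f x" using x by (simp add: j_map_def f_def X_def)
    finally show "(F - j_map n d f) x = 0" by simp
  qed
  hence "F = j_map n d f" by simp
  \<comment> \<open>With the identity as group element, \<open>F\<close> is itself one of the
    generators.\<close>
  also have "\<dots> = ract n d (1\<^sub>m d) (j_map n d f)" using ract_one[OF jfR] ..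
  also have "\<dots> \<in> polarization_algebra n d H"
    unfolding polarization_algebra_def using fI GL_one by (intro generated_algebra.gen) blast
  finally show ?thesis .
qed

theorem corollary14:
  fixes n d :: nat and H :: "'a::alg_closed_field mat set"
  assumes "d \<ge> n"
    and "subgroup H (GL n)"
    and "has_good_filtration d (right_transl (carrier_mat n d)) (polarization_algebra n d H)"
  shows "polarization_algebra n d H = invariants n d H"
proof -
  have H: "H \<subseteq> carrier (GL n)" using assms(2) by (rule subgroup.subset)
  show ?thesis
  proof (rule good_filtration_eqI[OF assms(3) subspace_polarization_algebra[OF H assms(1)]
        stable_invariants[OF H] polarization_subset_invariants[OF H assms(1)]])
    show "invariants n d H \<subseteq> mat_poly_funs n d" unfolding invariants_def by blast
  qed (rule unipotent_highest_weight[OF H assms(1)])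
qed

end
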